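(* Let $A$ be a ring and $\mathcal{C}$ a full subcategory of rings. Let $X$ and $Y$ be two sets of primitive morphisms with parameters in $A$, such that for all finite subsets $X_0$ of $X$ and $Y_0$ of $Y$ and every finite subcategory $I$ of $\mathcal{D}_A$ containing (as objects) the parameters of the elements of $X_0\cup Y_0$, there exists a cocone for the restriction $D_{A\lceil I}$ of $D_A$ to $I$, with vertex in $\mathcal{C}$, realising $X_0$ and avoiding $Y_0$. Then there exists a ring homomorphism $f:A\to B$ into an ultraproduct $B$ of rings of $\mathcal{C}$, realising $X$ and avoiding $Y$.
   Context: All rings are commutative and unitary. Let $\mathbb{A}^{op}$ be the small full subcategory of rings whose objects are the finitely presented rings $\mathbb{Z}[x_1,\ldots,x_n]/(p_1,\ldots,p_m)$. A morphism $m:P\to Q$ of $\mathbb{A}^{op}$ is called primitive. For a ring $A$ and $P$ in $\mathbb{A}^{op}$, $A_P=\hom(P,A)$ is the set of ring homomorphisms $P\to A$; for $m:P\to Q$ primitive, $A_m:A_Q\to A_P$ is the map $c\mapsto cm$, and $\exists_m A:=A_m(A_Q)=\{a\in A_P : \exists c\in A_Q,\ cm=a\}$. The category $\mathcal{D}_A$ of elements of $A$ has as objects the elements $a\in\bigcup_P A_P$, and as morphisms from $a\in A_P$ to $b\in A_Q$ the ring homomorphisms $u:P\to Q$ with $bu=a$; the canonical diagram $D_A:\mathcal{D}_A\to\mathbb{A}^{op}$ is the forgetful functor sending $a\in A_P$ to $P$. A primitive morphism with parameter in $A$ is a pair $(m,a)$ where $m:P\to Q$ is primitive and $a\in A_P$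 (the parameter). If $X$ is a set of primitive morphisms with parameters among the objects of a subcategory $I$ of $\mathcal{D}_A$, a cocone $(B,(f_b)_{b\in I_0})$ for $D_{A\lceil I}$ in rings (with vertex a ring $B$; $I_0$ the objects of $I$) realises $X$ if $f_a\in\exists_m B$ for every $(m,a)\in X$, and avoids $X$ if $f_a\notin\exists_m B$ for every $(m,a)\in X$. A ring homomorphism $f:A\to B$ realises (resp. avoids) $X$ if the cocone $(B,(f\circ a)_{a})$ for $D_A$ does. For an ultrafilter $\mathcal{U}$ on a set $J$ and a family of rings $(B_j)_{j\in J}$, the ultraproduct $\prod_{\mathcal{U}}B_j$ is the directed colimit of the products $\prod_{j\in S}B_j$, $S\in\mathcal{U}$, along the projections. *)

theory Defs
  imports "HOL-Algebra.QuotRing" "HOL-Library.Poly_Mapping"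
begin

section \<open>Ring homomorphisms as a set of maps\<close>

text \<open>A map between carriers is represented by the function which is \<^const>\<open>undefined\<close> outside
  the source carrier, so that equality of homomorphisms is equality in HOL and composition is
  \<^const>\<open>compose\<close>.\<close>

definition Hom :: "('a, 'c) ring_scheme \<Rightarrow> ('b, 'd) ring_scheme \<Rightarrow> ('a \<Rightarrow> 'b) set"
  where "Hom R S = ring_hom R S \<inter> extensional (carrier R)"


section \<open>The category of finitely presented rings\<close>

text \<open>An integer polynomial in the variables \<open>x\<^sub>0, x\<^sub>1, \<dots>\<close> is a finitely supported map from
  monomials (finitely supported exponent vectors) to coefficients.\<close>

type_synonym zpoly = "(nat \<Rightarrow>\<^sub>0 nat) \<Rightarrow>\<^sub>0 int"

definition zpoly_vars :: "zpoly \<Rightarrow> nat set"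
  where "zpoly_vars p = (\<Union>m\<in>Poly_Mapping.keys p. Poly_Mapping.keys m)"

definition zpoly_ring :: "nat \<Rightarrow> zpoly ring"
  where "zpoly_ring n =
    \<lparr> carrier = {p. zpoly_vars p \<subseteq> {..<n}},
      monoid.mult = (*), monoid.one = 1, ring.zero = 0, ring.add = (+) \<rparr>"

type_synonym fpring = "zpoly set ring"

definition fp_rings :: "fpring set"
  where "fp_rings = {zpoly_ring n Quot (Idl\<^bsub>zpoly_ring n\<^esub> F) | n F.
    finite F \<and> F \<subseteq> carrier (zpoly_ring n)}"

text \<open>A primitive morphism \<open>m : P \<rightarrow> Q\<close> is the triple \<open>(P, Q, m)\<close>.\<close>

type_synonym prim = "fpring \<times> fpring \<times> (zpoly set \<Rightarrow> zpoly set)"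

definition prims :: "prim set"
  where "prims = {(P, Q, m). P \<in> fp_rings \<and> Q \<in> fp_rings \<and> m \<in> Hom P Q}"

definition prim_dom :: "prim \<Rightarrow> fpring"
  where "prim_dom = (\<lambda>(P, Q, m). P)"

text \<open>\<open>ex_image B m\<close> is the image of \<open>c \<mapsto> c m\<close>, from \<open>Hom Q B\<close> to \<open>Hom P B\<close>.\<close>

definition ex_image :: "'b ring \<Rightarrow> prim \<Rightarrow> (zpoly set \<Rightarrow> 'b) set"
  where "ex_image B = (\<lambda>(P, Q, m). (\<lambda>c. compose (carrier P) c m) ` Hom Q B)"


section \<open>The category of elements of a ring\<close>

text \<open>An element \<open>a \<in> Hom P A\<close> is recorded together with its domain \<open>P\<close>; the canonical diagram
  is thus \<^const>\<open>fst\<close> on objects. An arrow \<open>u : x \<rightarrow> y\<close> is the triple \<open>(x, u, y)\<close>.\<close>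

type_synonym 'a el = "fpring \<times> (zpoly set \<Rightarrow> 'a)"

type_synonym 'a el_arr = "'a el \<times> (zpoly set \<Rightarrow> zpoly set) \<times> 'a el"

definition elements :: "'a ring \<Rightarrow> 'a el set"
  where "elements A = {(P, a). P \<in> fp_rings \<and> a \<in> Hom P A}"

definition element_arrows :: "'a ring \<Rightarrow> 'a el_arr set"
  where "element_arrows A = {((P, a), u, (Q, b)) | P a u Q b.
    (P, a) \<in> elements A \<and> (Q, b) \<in> elements A \<and> u \<in> Hom P Q \<and> compose (carrier P) b u = a}"

definition finite_subcategory :: "'a ring \<Rightarrow> 'a el set \<Rightarrow> 'a el_arr set \<Rightarrow> bool"
  where "finite_subcategory A I0 I1 \<longleftrightarrow>
    I0 \<subseteq> elements A \<and> I1 \<subseteq> element_arrows A \<and> finite I0 \<and> finite I1 \<and>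
    (\<forall>x u y. (x, u, y) \<in> I1 \<longrightarrow> x \<in> I0 \<and> y \<in> I0) \<and>
    (\<forall>x\<in>I0. (x, restrict id (carrier (fst x)), x) \<in> I1) \<and>
    (\<forall>x u y v z. (x, u, y) \<in> I1 \<and> (y, v, z) \<in> I1 \<longrightarrow>
      (x, compose (carrier (fst x)) v u, z) \<in> I1)"

text \<open>Cocones for the restriction of the canonical diagram to the subcategory with objects \<open>I0\<close>
  and arrows \<open>I1\<close>. The values of the family \<open>f\<close> outside \<open>I0\<close> are irrelevant.\<close>

definition cocone ::
  "'a el set \<Rightarrow> 'a el_arr set \<Rightarrow> 'b ring \<Rightarrow> ('a el \<Rightarrow> zpoly set \<Rightarrow> 'b) \<Rightarrow> bool"
  where "cocone I0 I1 B f \<longleftrightarrow>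
    (\<forall>x\<in>I0. f x \<in> Hom (fst x) B) \<and>
    (\<forall>x u y. (x, u, y) \<in> I1 \<longrightarrow> compose (carrier (fst x)) (f y) u = f x)"


section \<open>Primitive morphisms with parameters\<close>

type_synonym 'a param_prim = "prim \<times> (zpoly set \<Rightarrow> 'a)"

definition param_prims :: "'a ring \<Rightarrow> 'a param_prim set"
  where "param_prims A = {(m, a). m \<in> prims \<and> a \<in> Hom (prim_dom m) A}"

definition parameter :: "'a param_prim \<Rightarrow> 'a el"
  where "parameter = (\<lambda>(m, a). (prim_dom m, a))"

definition realises :: "'b ring \<Rightarrow> ('a el \<Rightarrow> zpoly set \<Rightarrow> 'b) \<Rightarrow> 'a param_prim set \<Rightarrow> bool"
  where "realises B f X \<longleftrightarrow> (\<forall>q\<in>X. f (parameter q) \<in> ex_image B (fst q))"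

definition avoids :: "'b ring \<Rightarrow> ('a el \<Rightarrow> zpoly set \<Rightarrow> 'b) \<Rightarrow> 'a param_prim set \<Rightarrow> bool"
  where "avoids B f X \<longleftrightarrow> (\<forall>q\<in>X. f (parameter q) \<notin> ex_image B (fst q))"

text \<open>The cocone \<open>(f \<circ> a)\<^sub>a\<close> for the whole canonical diagram induced by \<open>f : A \<rightarrow> B\<close>.\<close>

definition hom_cocone :: "('a \<Rightarrow> 'b) \<Rightarrow> 'a el \<Rightarrow> zpoly set \<Rightarrow> 'b"
  where "hom_cocone f = (\<lambda>(P, a). compose (carrier P) f a)"


section \<open>Ultraproducts of rings\<close>

definition ultrafilter_on :: "'j set \<Rightarrow> 'j set set \<Rightarrow> bool"
  where "ultrafilter_on J U \<longleftrightarrow>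
    U \<subseteq> Pow J \<and> J \<in> U \<and> {} \<notin> U \<and>
    (\<forall>S T. S \<in> U \<and> S \<subseteq> T \<and> T \<subseteq> J \<longrightarrow> T \<in> U) \<and>
    (\<forall>S\<in>U. \<forall>T\<in>U. S \<inter> T \<in> U) \<and>
    (\<forall>S. S \<subseteq> J \<longrightarrow> S \<in> U \<or> J - S \<in> U)"

definition product_ring :: "'j set \<Rightarrow> ('j \<Rightarrow> 'b ring) \<Rightarrow> ('j \<Rightarrow> 'b) ring"
  where "product_ring S B =
    \<lparr> carrier = (\<Pi>\<^sub>E j\<in>S. carrier (B j)),
      monoid.mult = (\<lambda>x y. \<lambda>j\<in>S. x j \<otimes>\<^bsub>B j\<^esub> y j),
      monoid.one = (\<lambda>j\<in>S. \<one>\<^bsub>B j\<^esub>),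
      ring.zero = (\<lambda>j\<in>S. \<zero>\<^bsub>B j\<^esub>),
      ring.add = (\<lambda>x y. \<lambda>j\<in>S. x j \<oplus>\<^bsub>B j\<^esub> y j) \<rparr>"

text \<open>The directed colimit of rings \<open>R i\<close>, for \<open>i\<close> in a set \<open>D\<close> directed by \<open>leq\<close>, along
  transition maps \<open>t i k : R i \<rightarrow> R k\<close> for \<open>leq i k\<close>: the disjoint union of the \<open>R i\<close> modulo eventual
  equality. The unions below range over sets of representatives and stages, and all the classes
  united coincide.\<close>

definition colim_rel ::
  "'i set \<Rightarrow> ('i \<Rightarrow> 'i \<Rightarrow> bool) \<Rightarrow> ('i \<Rightarrow> 'r ring) \<Rightarrow> ('i \<Rightarrow> 'i \<Rightarrow> 'r \<Rightarrow> 'r) \<Rightarrow> ('i \<times> 'r) rel"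
  where "colim_rel D leq R t = {((i, x), (j, y)).
    i \<in> D \<and> x \<in> carrier (R i) \<and> j \<in> D \<and> y \<in> carrier (R j) \<and>
    (\<exists>k\<in>D. leq i k \<and> leq j k \<and> t i k x = t j k y)}"

definition directed_colimit ::
  "'i set \<Rightarrow> ('i \<Rightarrow> 'i \<Rightarrow> bool) \<Rightarrow> ('i \<Rightarrow> 'r ring) \<Rightarrow> ('i \<Rightarrow> 'i \<Rightarrow> 'r \<Rightarrow> 'r) \<Rightarrow> ('i \<times> 'r) set ring"
  where "directed_colimit D leq R t = (let E = colim_rel D leq R t in
    \<lparr> carrier = (SIGMA i:D. carrier (R i)) // E,
      monoid.mult = (\<lambda>p q. \<Union>{E `` {(k, t i k x \<otimes>\<^bsub>R k\<^esub> t j k y)} | i x j y k.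
        (i, x) \<in> p \<and> (j, y) \<in> q \<and> k \<in> D \<and> leq i k \<and> leq j k}),
      monoid.one = (\<Union>i\<in>D. E `` {(i, \<one>\<^bsub>R i\<^esub>)}),
      ring.zero = (\<Union>i\<in>D. E `` {(i, \<zero>\<^bsub>R i\<^esub>)}),
      ring.add = (\<lambda>p q. \<Union>{E `` {(k, t i k x \<oplus>\<^bsub>R k\<^esub> t j k y)} | i x j y k.
        (i, x) \<in> p \<and> (j, y) \<in> q \<and> k \<in> D \<and> leq i k \<and> leq j k}) \<rparr>)"

text \<open>The members of an ultrafilter \<open>U\<close> are ordered by reverse inclusion.\<close>

definition ultraproduct :: "'j set set \<Rightarrow> ('j \<Rightarrow> 'b ring) \<Rightarrow> ('j set \<times> ('j \<Rightarrow> 'b)) set ring"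
  where "ultraproduct U B =
    directed_colimit U (\<lambda>S T. T \<subseteq> S) (\<lambda>S. product_ring S B) (\<lambda>S T x. restrict x T)"

text \<open>A type large enough to index the ultraproduct: HOL cannot quantify existentially over the
  type of the index set, so it is fixed here. Its elements are the tuples \<open>(X\<^sub>0, Y\<^sub>0, I\<^sub>0, I\<^sub>1)\<close> of two
  sets of primitive morphisms with parameters and a subcategory.\<close>

type_synonym 'a ultra_index =
  "'a param_prim set \<times> 'a param_prim set \<times> 'a el set \<times> 'a el_arr set"

end

theory Submission
  imports Defs "HOL-Algebra.Free_Abelian_Groups"
begin

text \<open>Choose a cocone for every finite test \<open>j = (X\<^sub>0, Y\<^sub>0, I)\<close>, with vertex \<open>B\<^sub>j\<close> and
  components \<open>f\<^sub>j\<close>. Finite subcategories are not directed: two of them may generate an infinite one.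
  But every finite diagram of elements has a cocone \<open>u\<close> in the category of elements, and the star
  formed by its legs is a finite subcategory. A cocone for the star, composed with the legs, commutes
  with all arrows of the diagram. Hence the sets of those \<open>j\<close> that contain given parameters and
  whose cocone commutes with finitely many given arrows have the finite intersection property, and
  an ultrafilter contains them all. An element \<open>a\<close> of \<open>A\<close> is an object with domain \<open>\<int>[x]\<close>, and is
  mapped to the class of the family \<open>f\<^sub>j(a)(x)\<close>. As finitely presented rings involve finitely many
  generators and relations, a homomorphism from such a ring to the ultraproduct is a class of
  homomorphisms to the factors, so that membership in \<open>\<exists>\<^sub>m\<close> holds in the ultraproduct if and only
  if it holds in almost all factors.\<close>

section \<open>Integer polynomials\<close>

text \<open>The additive group of polynomials is the free abelian group on the monomials, with basis
  \<open>frag_of\<close>. Writing a variable as a basis element makes \<open>frag_induction\<close>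
  and the universal property of free abelian groups available.\<close>

definition zvar :: "nat \<Rightarrow> zpoly"
  where "zvar i = frag_of (Poly_Mapping.single i 1)"

lemma zpoly_ring_simps [simp]:
  "mult (zpoly_ring n) = (*)" "one (zpoly_ring n) = 1"
  "ring.zero (zpoly_ring n) = 0" "add (zpoly_ring n) = (+)"
  by (simp_all add: zpoly_ring_def)

lemma carrier_zpoly_ring:
  "carrier (zpoly_ring n) = {p. \<forall>m\<in>Poly_Mapping.keys p. Poly_Mapping.keys m \<subseteq> {..<n}}"
  by (auto simp: zpoly_ring_def zpoly_vars_def)

lemma zero_in_zpoly_ring [simp]: "0 \<in> carrier (zpoly_ring n)"
  and one_in_zpoly_ring [simp]: "1 \<in> carrier (zpoly_ring n)"
  by (auto simp: carrier_zpoly_ring)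

lemma zvar_in_zpoly_ring [simp]: "zvar i \<in> carrier (zpoly_ring n) \<longleftrightarrow> i < n"
  by (auto simp: carrier_zpoly_ring zvar_def)

lemma zpoly_ring_add_closed:
  "p \<in> carrier (zpoly_ring n) \<Longrightarrow> q \<in> carrier (zpoly_ring n) \<Longrightarrow> p + q \<in> carrier (zpoly_ring n)"
  using Poly_Mapping.keys_add[of p q] by (fastforce simp: carrier_zpoly_ring)

lemma zpoly_ring_diff_closed:
  "p \<in> carrier (zpoly_ring n) \<Longrightarrow> q \<in> carrier (zpoly_ring n) \<Longrightarrow> p - q \<in> carrier (zpoly_ring n)"
  using keys_diff[of p q] by (fastforce simp: carrier_zpoly_ring)

lemma zpoly_ring_mult_closed:
  assumes "p \<in> carrier (zpoly_ring n)" "q \<in> carrier (zpoly_ring n)"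
  shows "p * q \<in> carrier (zpoly_ring n)"
proof -
  have "Poly_Mapping.keys m \<subseteq> {..<n}" if m: "m \<in> Poly_Mapping.keys (p * q)" for m
  proof -
    obtain a b where ab: "m = a + b" "a \<in> Poly_Mapping.keys p" "b \<in> Poly_Mapping.keys q"
      using m Poly_Mapping.keys_mult[of p q] by blast
    have "Poly_Mapping.keys a \<subseteq> {..<n}" "Poly_Mapping.keys b \<subseteq> {..<n}"
      using assms ab by (auto simp: carrier_zpoly_ring)
    then show ?thesis
      using Poly_Mapping.keys_add[of a b] ab by blast
  qed
  then show ?thesis
    by (simp add: carrier_zpoly_ring)
qed

lemma cring_zpoly_ring: "cring (zpoly_ring n)"
proof (rule cringI)
  show "abelian_group (zpoly_ring n)"
  proof (rule abelian_groupI)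
    fix x assume x: "x \<in> carrier (zpoly_ring n)"
    have "0 - x \<in> carrier (zpoly_ring n)"
      using zpoly_ring_diff_closed[OF _ x, of 0] by simp
    then show "\<exists>y\<in>carrier (zpoly_ring n). y \<oplus>\<^bsub>zpoly_ring n\<^esub> x = \<zero>\<^bsub>zpoly_ring n\<^esub>"
      by (intro bexI[of _ "0 - x"]) simp_all
  qed (simp_all add: zpoly_ring_add_closed algebra_simps)
  show "comm_monoid (zpoly_ring n)"
    by (rule comm_monoidI) (simp_all add: zpoly_ring_mult_closed algebra_simps)
qed (simp add: algebra_simps)

lemma ring_zpoly_ring: "ring (zpoly_ring n)"
  by (rule cring.axioms(1)[OF cring_zpoly_ring])

lemma zpoly_ring_minus:
  assumes "p \<in> carrier (zpoly_ring n)" "q \<in> carrier (zpoly_ring n)"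
  shows "p \<ominus>\<^bsub>zpoly_ring n\<^esub> q = p - q"
proof -
  interpret cring "zpoly_ring n" by (rule cring_zpoly_ring)
  have "(p - q) \<oplus>\<^bsub>zpoly_ring n\<^esub> q = p" by simp
  then show ?thesis
    using assms zpoly_ring_diff_closed[OF assms] add.inv_solve_right' minus_eq by metis
qed

section \<open>Generation and freeness of the polynomial rings\<close>

lemma frag_of_add: "frag_of (a + b) = frag_of a * (frag_of b :: zpoly)"
  by (simp add: mult_single)

text \<open>Induction on the total degree reaches every monomial from \<open>1\<close> and the
  variables by products; differences then reach all integer combinations. Cases for \<open>0\<close>
  and for sums would be redundant, since \<open>0 = 1 - 1\<close> and
  \<open>a + b = a - (0 - b)\<close>.\<close>

lemma zpoly_ring_induct [consumes 1, case_names one var diff mult]: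
  assumes p: "p \<in> carrier (zpoly_ring n)"
    and one: "P 1" and var: "\<And>i. i < n \<Longrightarrow> P (zvar i)"
    and diff: "\<And>a b. \<lbrakk>a \<in> carrier (zpoly_ring n); b \<in> carrier (zpoly_ring n); P a; P b\<rbrakk>
      \<Longrightarrow> P (a - b)"
    and mult: "\<And>a b. \<lbrakk>a \<in> carrier (zpoly_ring n); b \<in> carrier (zpoly_ring n); P a; P b\<rbrakk>
      \<Longrightarrow> P (a * b)"
  shows "P p"
proof -
  have mono: "P (frag_of m)" if "Poly_Mapping.keys m \<subseteq> {..<n}" for m
    using that
  proof (induction "\<Sum>i<n. Poly_Mapping.lookup m i" arbitrary: m rule: less_induct)
    case less
    show ?case
    proof (cases "m = 0")
      case True
      then show ?thesis using one by simp
    next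
      case False
      then obtain i where i: "i \<in> Poly_Mapping.keys m"
        by fastforce
      define m' where "m' = m - Poly_Mapping.single i 1"
      have lm: "Poly_Mapping.lookup m i \<noteq> 0"
        using i by (simp add: in_keys_iff)
      \<comment> \<open>Subtraction of exponents is truncated, so \<open>m\<close> is recovered from
        \<open>m'\<close> only because \<open>lm\<close> makes the exponent of variable
        \<open>i\<close> positive.\<close>
      have m: "m = Poly_Mapping.single i 1 + m'"
        by (rule poly_mapping_eqI)
          (use lm in \<open>auto simp: m'_def lookup_add lookup_minus lookup_single when_def\<close>)
      have km': "Poly_Mapping.keys m' \<subseteq> {..<n}"
      proof -
        have "Poly_Mapping.keys m' \<subseteq> Poly_Mapping.keys m"
          by (auto simp: m'_def in_keys_iff lookup_minus)
        then show ?thesis using less.prems by blast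
      qed
      have "(\<Sum>i<n. Poly_Mapping.lookup m' i) < (\<Sum>i<n. Poly_Mapping.lookup m i)"
        using i less.prems lm
        by (intro sum_strict_mono_ex1)
          (auto simp: m'_def lookup_minus lookup_single when_def intro!: bexI[of _ i])
      from less.hyps[OF this km'] have "P (frag_of m')" .
      moreover have "frag_of m' \<in> carrier (zpoly_ring n)"
        using km' by (simp add: carrier_zpoly_ring)
      moreover have "i < n" using i less.prems by blast
      ultimately have "P (zvar i * frag_of m')"
        by (intro mult var) simp_all
      then show ?thesis
        by (subst m) (simp add: frag_of_add zvar_def)
    qed
  qed
  have "Poly_Mapping.keys p \<subseteq> {m. Poly_Mapping.keys m \<subseteq> {..<n}}"
    using p by (auto simp: carrier_zpoly_ring)
  \<comment> \<open>Membership is carried through the induction because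
    \<open>frag_induction\<close> does not record it for the operands of a difference, while the
    assumption on differences asks for it.\<close>
  then have "p \<in> carrier (zpoly_ring n) \<and> P p"
  proof (induction rule: frag_induction)
    case zero
    then show ?case using diff[OF _ _ one one] by simp
  next
    case (one m)
    then show ?case using mono[of m] by (simp add: carrier_zpoly_ring)
  next
    case (diff a b)
    then show ?case using assms(4) zpoly_ring_diff_closed by blast
  qed
  then show ?thesis ..
qed

lemma ring_hom_diff:
  assumes "ring R" "ring S" "h \<in> ring_hom R S" "a \<in> carrier R" "b \<in> carrier R"
  shows "h (a \<ominus>\<^bsub>R\<^esub> b) = h a \<ominus>\<^bsub>S\<^esub> h b"
proof -
  interpret ring_hom_ring R S h
    using assms by (intro ring_hom_ringI2)
  show ?thesis
    using assms by (simp add: a_minus_def)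
qed

lemma zpoly_ring_hom_eqI:
  assumes R: "ring R" and h: "h \<in> ring_hom (zpoly_ring n) R" and g: "g \<in> ring_hom (zpoly_ring n) R"
    and var: "\<And>i. i < n \<Longrightarrow> h (zvar i) = g (zvar i)" and p: "p \<in> carrier (zpoly_ring n)"
  shows "h p = g p"
  using p
proof (induction rule: zpoly_ring_induct)
  case one
  show ?case using ring_hom_one[OF h] ring_hom_one[OF g] by simp
next
  case (diff a b)
  then show ?case
    using ring_hom_diff[OF ring_zpoly_ring R h, of a b] ring_hom_diff[OF ring_zpoly_ring R g, of a b]
    by (simp add: zpoly_ring_minus)
next
  case (mult a b)
  then show ?case
    using ring_hom_mult[OF h, of a b] ring_hom_mult[OF g, of a b] by simp
qed (rule var)

text \<open>Evaluation on monomials, \<open>\<mu>\<close>, extends additively by the universal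
  property of the free abelian group on them. It is multiplicative because \<open>\<mu>\<close>
  turns sums of exponents into products and both sides of the product rule are biadditive.\<close>

lemma zpoly_ring_hom_exists:
  assumes R: "cring R" and \<phi>: "\<And>i. i < n \<Longrightarrow> \<phi> i \<in> carrier R"
  shows "\<exists>h\<in>ring_hom (zpoly_ring n) R. \<forall>i<n. h (zvar i) = \<phi> i"
proof -
  interpret R: cring R by fact
  define S where "S = {m :: nat \<Rightarrow>\<^sub>0 nat. Poly_Mapping.keys m \<subseteq> {..<n}}"
  define \<mu> where "\<mu> m = (\<Otimes>\<^bsub>R\<^esub>i\<in>{..<n}. \<phi> i [^]\<^bsub>R\<^esub> Poly_Mapping.lookup m i)" for m :: "nat \<Rightarrow>\<^sub>0 nat"
  have \<mu>_closed: "\<mu> m \<in> carrier R" for m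
    unfolding \<mu>_def using \<phi> by (intro R.finprod_closed) auto
  have carrier_S: "p \<in> carrier (zpoly_ring n) \<longleftrightarrow> Poly_Mapping.keys p \<subseteq> S" for p
    by (auto simp: carrier_zpoly_ring S_def)
  obtain h where h: "h \<in> hom (free_Abelian_group S) (add_monoid R)"
    and h_mono: "\<And>m. m \<in> S \<Longrightarrow> h (frag_of m) = \<mu> m"
    by (rule comm_group.free_Abelian_group_universal[OF R.a_comm_group, of \<mu> S])
      (use \<mu>_closed in auto)
  have closed: "h p \<in> carrier R" if "p \<in> carrier (zpoly_ring n)" for p
    using hom_in_carrier[OF h, of p] that by (simp add: carrier_S)
  have add: "h (p + q) = h p \<oplus>\<^bsub>R\<^esub> h q"
    if "p \<in> carrier (zpoly_ring n)" "q \<in> carrier (zpoly_ring n)" for p q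
    using hom_mult[OF h, of p q] that by (simp add: carrier_S)
  have diff: "h (p - q) = h p \<ominus>\<^bsub>R\<^esub> h q"
    if "p \<in> carrier (zpoly_ring n)" "q \<in> carrier (zpoly_ring n)" for p q
  proof -
    have "h p = h (p - q) \<oplus>\<^bsub>R\<^esub> h q"
      using add[of "p - q" q] that zpoly_ring_diff_closed by simp
    then show ?thesis
      using that closed zpoly_ring_diff_closed[OF that]
      by (metis R.add.inv_solve_right R.minus_eq)
  qed
  have zero: "h 0 = \<zero>\<^bsub>R\<^esub>"
    using diff[of 0 0] closed[of 0] by (simp add: R.minus_eq R.r_neg)
  have \<mu>_add: "\<mu> (a + b) = \<mu> a \<otimes>\<^bsub>R\<^esub> \<mu> b" for a b
  proof -
    have "\<mu> (a + b) = (\<Otimes>\<^bsub>R\<^esub>i\<in>{..<n}. \<phi> i [^]\<^bsub>R\<^esub> Poly_Mapping.lookup a i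
        \<otimes>\<^bsub>R\<^esub> \<phi> i [^]\<^bsub>R\<^esub> Poly_Mapping.lookup b i)"
      unfolding \<mu>_def using \<phi>
      by (intro R.finprod_cong') (auto simp: lookup_add R.nat_pow_mult)
    also have "\<dots> = \<mu> a \<otimes>\<^bsub>R\<^esub> \<mu> b"
      unfolding \<mu>_def using \<phi> by (intro R.finprod_multf) auto
    finally show ?thesis .
  qed
  \<comment> \<open>Biadditivity is used one factor at a time: here the left factor is a fixed
    monomial and the induction runs over the right factor; \<open>mult\<close> then runs over the
    left one.\<close>
  have mult_mono: "h (frag_of a * q) = h (frag_of a) \<otimes>\<^bsub>R\<^esub> h q \<and> q \<in> carrier (zpoly_ring n)"
    if a: "a \<in> S" and q: "Poly_Mapping.keys q \<subseteq> S" for a q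
    using q
  proof (induction rule: frag_induction)
    case zero
    then show ?case using a by (simp add: \<open>h 0 = _\<close> h_mono \<mu>_closed)
  next
    case (one b)
    then have "a + b \<in> S"
      using a Poly_Mapping.keys_add[of a b] by (auto simp: S_def)
    then show ?case
      using one a h_mono[of "a + b"] by (simp add: frag_of_add h_mono \<mu>_add carrier_S)
  next
    case (diff p q)
    have "frag_of a \<in> carrier (zpoly_ring n)" using a by (simp add: carrier_S)
    then show ?case
      using diff a
      by (simp add: right_diff_distrib \<open>\<And>p q. _ \<Longrightarrow> _ \<Longrightarrow> h (p - q) = _\<close> zpoly_ring_mult_closed
          zpoly_ring_diff_closed closed R.r_minus R.r_distr R.minus_eq)
  qed
  have mult: "h (p * q) = h p \<otimes>\<^bsub>R\<^esub> h q \<and> p \<in> carrier (zpoly_ring n)"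
    if p: "Poly_Mapping.keys p \<subseteq> S" and q: "q \<in> carrier (zpoly_ring n)" for p q
    using p
  proof (induction rule: frag_induction)
    case zero
    then show ?case using q closed by (simp add: \<open>h 0 = _\<close>)
  next
    case (one b)
    then show ?case using mult_mono[of b q] q by (simp add: carrier_S)
  next
    case (diff p p')
    then show ?case
      using q
      by (simp add: left_diff_distrib \<open>\<And>p q. _ \<Longrightarrow> _ \<Longrightarrow> h (p - q) = _\<close> zpoly_ring_mult_closed
          zpoly_ring_diff_closed closed R.l_minus R.l_distr R.minus_eq)
  qed
  have "h 1 = \<one>\<^bsub>R\<^esub>"
    using h_mono[of 0] by (simp add: \<mu>_def S_def)
  moreover have "h (zvar i) = \<phi> i" if "i < n" for i
  proof -
    have "h (zvar i) = (\<Otimes>\<^bsub>R\<^esub>j\<in>{..<n}. if i = j then \<phi> j else \<one>\<^bsub>R\<^esub>)"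
      unfolding zvar_def using that \<phi>
      by (subst h_mono) (auto simp: S_def \<mu>_def lookup_single when_def intro!: R.finprod_cong')
    then show ?thesis
      using that \<phi> R.finprod_singleton[of i "{..<n}" \<phi>] by auto
  qed
  moreover have "h \<in> ring_hom (zpoly_ring n) R" if "h 1 = \<one>\<^bsub>R\<^esub>"
    using that closed add mult by (intro ring_hom_memI) (auto simp: carrier_S)
  ultimately show ?thesis by blast
qed

section \<open>Finitely presented rings\<close>

definition quot_proj :: "nat \<Rightarrow> zpoly set \<Rightarrow> zpoly \<Rightarrow> zpoly set"
  where "quot_proj n F p = Idl\<^bsub>zpoly_ring n\<^esub> F +>\<^bsub>zpoly_ring n\<^esub> p"

definition quot_ring :: "nat \<Rightarrow> zpoly set \<Rightarrow> fpring"
  where "quot_ring n F = zpoly_ring n Quot (Idl\<^bsub>zpoly_ring n\<^esub> F)"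

lemma fp_rings_iff:
  "P \<in> fp_rings \<longleftrightarrow> (\<exists>n F. finite F \<and> F \<subseteq> carrier (zpoly_ring n) \<and> P = quot_ring n F)"
  by (auto simp: fp_rings_def quot_ring_def)

lemma ideal_genideal_zpoly: "F \<subseteq> carrier (zpoly_ring n) \<Longrightarrow> ideal (Idl\<^bsub>zpoly_ring n\<^esub> F) (zpoly_ring n)"
  by (rule ring.genideal_ideal[OF ring_zpoly_ring])

lemma cring_quot_ring: "F \<subseteq> carrier (zpoly_ring n) \<Longrightarrow> cring (quot_ring n F)"
  unfolding quot_ring_def
  by (intro ideal.quotient_is_cring ideal_genideal_zpoly cring_zpoly_ring)

lemma cring_fp_ring: "P \<in> fp_rings \<Longrightarrow> cring P"
  by (auto simp: fp_rings_iff cring_quot_ring)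

lemma quot_proj_hom:
  "F \<subseteq> carrier (zpoly_ring n) \<Longrightarrow> quot_proj n F \<in> ring_hom (zpoly_ring n) (quot_ring n F)"
  unfolding quot_ring_def quot_proj_def[abs_def]
  by (intro ideal.rcos_ring_hom ideal_genideal_zpoly)

lemma carrier_quot_ring:
  "carrier (quot_ring n F) = quot_proj n F ` carrier (zpoly_ring n)"
  by (auto simp: quot_ring_def quot_proj_def FactRing_def A_RCOSETS_def')

lemma quot_proj_eq_iff:
  assumes F: "F \<subseteq> carrier (zpoly_ring n)"
    and "p \<in> carrier (zpoly_ring n)" "q \<in> carrier (zpoly_ring n)"
  shows "quot_proj n F p = quot_proj n F q \<longleftrightarrow> p - q \<in> Idl\<^bsub>zpoly_ring n\<^esub> F"
proof -
  interpret ideal "Idl\<^bsub>zpoly_ring n\<^esub> F" "zpoly_ring n"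
    by (rule ideal_genideal_zpoly[OF F])
  show ?thesis
    unfolding quot_proj_def
    using quotient_eq_iff_same_a_r_cos[OF ideal_axioms assms(2,3)] zpoly_ring_minus[OF assms(2,3)]
    by simp
qed

lemma quot_proj_eq_zero:
  assumes F: "F \<subseteq> carrier (zpoly_ring n)" and p: "p \<in> F"
  shows "quot_proj n F p = \<zero>\<^bsub>quot_ring n F\<^esub>"
proof -
  have "quot_proj n F p = quot_proj n F 0"
    using ring.genideal_self[OF ring_zpoly_ring F] F p
    by (subst quot_proj_eq_iff[OF F]) auto
  also have "\<dots> = \<zero>\<^bsub>quot_ring n F\<^esub>"
    using ring_hom_zero[OF quot_proj_hom[OF F] ring_zpoly_ring cring.axioms(1)[OF cring_quot_ring[OF F]]]
    by simp
  finally show ?thesis .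
qed

section \<open>Universal property of a finite presentation\<close>

lemma genideal_zpoly_hom_eq_zero:
  assumes F: "F \<subseteq> carrier (zpoly_ring n)" and R: "ring R" and h: "h \<in> ring_hom (zpoly_ring n) R"
    and hF: "\<And>p. p \<in> F \<Longrightarrow> h p = \<zero>\<^bsub>R\<^esub>" and p: "p \<in> Idl\<^bsub>zpoly_ring n\<^esub> F"
  shows "h p = \<zero>\<^bsub>R\<^esub>"
proof -
  interpret ring_hom_ring "zpoly_ring n" R h
    by (rule ring_hom_ringI2[OF ring_zpoly_ring R h])
  have "F \<subseteq> a_kernel (zpoly_ring n) R h"
    using F hF unfolding a_kernel_def' by blast
  from R.genideal_minimal[OF kernel_is_ideal this] show ?thesis
    using p unfolding a_kernel_def' by blast
qed

text \<open>Each coset is sent to the value of \<open>h\<close> at a chosen representative. Two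
  representatives differ by an element of the ideal generated by \<open>F\<close>, which lies in the
  kernel of \<open>h\<close>, so the choice does not matter.\<close>

lemma quot_ring_lift:
  assumes F: "F \<subseteq> carrier (zpoly_ring n)" and R: "ring R" and h: "h \<in> ring_hom (zpoly_ring n) R"
    and hF: "\<And>p. p \<in> F \<Longrightarrow> h p = \<zero>\<^bsub>R\<^esub>"
  obtains g where "g \<in> Hom (quot_ring n F) R"
    "\<And>p. p \<in> carrier (zpoly_ring n) \<Longrightarrow> g (quot_proj n F p) = h p"
proof
  let ?Z = "carrier (zpoly_ring n)" and ?\<pi> = "quot_proj n F"
  define g where "g = (\<lambda>x\<in>carrier (quot_ring n F). h (inv_into ?Z ?\<pi> x))"
  have hR: "h p \<in> carrier R" if "p \<in> ?Z" for p
    using ring_hom_closed[OF h that] .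
  show g: "g (?\<pi> p) = h p" if p: "p \<in> ?Z" for p
  proof -
    define q where "q = inv_into ?Z ?\<pi> (?\<pi> p)"
    have q: "q \<in> ?Z" "?\<pi> q = ?\<pi> p"
      using p by (auto simp: q_def inv_into_into f_inv_into_f)
    have qp: "q - p \<in> ?Z" and "h (q - p) = \<zero>\<^bsub>R\<^esub>"
      using p q genideal_zpoly_hom_eq_zero[OF F R h hF] quot_proj_eq_iff[OF F]
      by (auto intro: zpoly_ring_diff_closed)
    then have "h q = h p"
      using ring_hom_add[OF h qp p] hR[OF p] ring.ring_simprules(8)[OF R] by simp
    then show ?thesis
      using p by (simp add: g_def q_def carrier_quot_ring)
  qed
  note \<pi> = quot_proj_hom[OF F]
  have "g \<in> ring_hom (quot_ring n F) R"
  proof (rule ring_hom_memI)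
    fix x y assume "x \<in> carrier (quot_ring n F)" "y \<in> carrier (quot_ring n F)"
    then obtain p q where pq: "p \<in> ?Z" "q \<in> ?Z" "x = ?\<pi> p" "y = ?\<pi> q"
      by (auto simp: carrier_quot_ring)
    show "g x \<in> carrier R"
      using pq by (simp add: g hR)
    show "g (x \<otimes>\<^bsub>quot_ring n F\<^esub> y) = g x \<otimes>\<^bsub>R\<^esub> g y"
      using pq g[OF zpoly_ring_mult_closed[OF pq(1,2)]] ring_hom_mult[OF \<pi>, of p q] ring_hom_mult[OF h, of p q]
      by (simp add: g)
    show "g (x \<oplus>\<^bsub>quot_ring n F\<^esub> y) = g x \<oplus>\<^bsub>R\<^esub> g y"
      using pq g[OF zpoly_ring_add_closed[OF pq(1,2)]] ring_hom_add[OF \<pi>, of p q] ring_hom_add[OF h, of p q]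
      by (simp add: g)
  next
    show "g \<one>\<^bsub>quot_ring n F\<^esub> = \<one>\<^bsub>R\<^esub>"
      using g[of 1] ring_hom_one[OF \<pi>] ring_hom_one[OF h] by simp
  qed
  then show "g \<in> Hom (quot_ring n F) R"
    by (simp add: Hom_def g_def)
qed

text \<open>After composition with the projection both maps are determined by the variables.
  Equality of homomorphisms thus becomes finitely many equations, which is the form that an
  ultrafilter can handle.\<close>

lemma Hom_quot_ring_eqI:
  assumes F: "F \<subseteq> carrier (zpoly_ring n)" and R: "ring R"
    and g: "g \<in> Hom (quot_ring n F) R" and g': "g' \<in> Hom (quot_ring n F) R"
    and var: "\<And>i. i < n \<Longrightarrow> g (quot_proj n F (zvar i)) = g' (quot_proj n F (zvar i))"
  shows "g = g'"
proof (rule extensionalityI)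
  show "g \<in> extensional (carrier (quot_ring n F))" "g' \<in> extensional (carrier (quot_ring n F))"
    using g g' by (auto simp: Hom_def)
  fix x assume "x \<in> carrier (quot_ring n F)"
  then obtain p where p: "p \<in> carrier (zpoly_ring n)" "x = quot_proj n F p"
    by (auto simp: carrier_quot_ring)
  have "(g \<circ> quot_proj n F) p = (g' \<circ> quot_proj n F) p"
    using R _ _ _ p(1)
  proof (rule zpoly_ring_hom_eqI)
    show "g \<circ> quot_proj n F \<in> ring_hom (zpoly_ring n) R"
      "g' \<circ> quot_proj n F \<in> ring_hom (zpoly_ring n) R"
      using ring_hom_trans[OF quot_proj_hom[OF F]] g g' by (auto simp: Hom_def)
  qed (simp add: var)
  then show "g x = g' x"
    by (simp add: p)
qed

lemma Hom_compose:
  assumes "ring P" and f: "f \<in> Hom P Q" and g: "g \<in> Hom Q R"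
  shows "compose (carrier P) g f \<in> Hom P R"
proof -
  interpret ring P by fact
  have f: "f \<in> ring_hom P Q" and g: "g \<in> ring_hom Q R"
    using f g by (auto simp: Hom_def)
  have "compose (carrier P) g f \<in> ring_hom P R"
    using ring_hom_trans[OF f g]
    by (auto simp: ring_hom_def compose_eq Pi_iff)
  then show ?thesis
    by (simp add: Hom_def)
qed

text \<open>The elements of the quotient are cosets, and every polynomial lies in its own
  coset.\<close>

lemma Union_carrier_quot_ring:
  assumes F: "F \<subseteq> carrier (zpoly_ring n)"
  shows "\<Union>(carrier (quot_ring n F)) = carrier (zpoly_ring n)"
proof -
  interpret ideal "Idl\<^bsub>zpoly_ring n\<^esub> F" "zpoly_ring n"
    by (rule ideal_genideal_zpoly[OF F])
  have "p \<in> quot_proj n F p" if "p \<in> carrier (zpoly_ring n)" for p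
    unfolding quot_proj_def by (rule a_rcos_self[OF that])
  moreover have "quot_proj n F p \<subseteq> carrier (zpoly_ring n)" if "p \<in> carrier (zpoly_ring n)" for p
    unfolding quot_proj_def by (rule a_r_coset_subset_G[OF a_subset that])
  ultimately show ?thesis
    by (auto simp: carrier_quot_ring)
qed

text \<open>The union of the cosets is the whole polynomial ring, so a quotient, as a set of cosets,
  remembers its number of variables. This is what allows an object outside a given finite set to be
  produced by adding variables.\<close>

lemma quot_ring_eq_imp_eq:
  assumes "F \<subseteq> carrier (zpoly_ring n)" "F' \<subseteq> carrier (zpoly_ring n')"
    and "quot_ring n F = quot_ring n' F'"
  shows "n = n'"
proof -
  have "carrier (zpoly_ring n) = carrier (zpoly_ring n')"
    using Union_carrier_quot_ring[OF assms(1)] Union_carrier_quot_ring[OF assms(2)] assms(3) by simp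
  then have "i < n \<longleftrightarrow> i < n'" for i
    using zvar_in_zpoly_ring by blast
  then show ?thesis
    by (meson linorder_neqE_nat less_irrefl)
qed

section \<open>Finite diagrams in the category of elements\<close>

text \<open>The vertex \<open>Q\<close> has variables for the values in \<open>A\<close> of all
  generators of the rings in \<open>Ob\<close>. Its relations are those of these rings together with
  one commutation equation for each arrow and each generator of its source. There are finitely many,
  and all hold in \<open>A\<close>, so evaluation in \<open>A\<close> factors through
  \<open>Q\<close> and gives \<open>b\<close>.\<close>

lemma elements_cocone_exists:
  assumes A: "cring A"
    and objs: "finite Ob" "Ob \<subseteq> elements A"
    and arrs: "finite Ar" "Ar \<subseteq> element_arrows A" "\<And>x v y. (x, v, y) \<in> Ar \<Longrightarrow> x \<in> Ob \<and> y \<in> Ob"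
  obtains Q b u where "(Q, b) \<in> elements A" "(Q, b) \<notin> Ob"
    "\<And>x. x \<in> Ob \<Longrightarrow> u x \<in> Hom (fst x) Q"
    "\<And>x. x \<in> Ob \<Longrightarrow> compose (carrier (fst x)) b (u x) = snd x"
    "\<And>x v y. (x, v, y) \<in> Ar \<Longrightarrow> compose (carrier (fst x)) (u y) v = u x"
proof -
  interpret A: cring A by fact
  have "\<exists>nF. finite (snd nF) \<and> snd nF \<subseteq> carrier (zpoly_ring (fst nF))
      \<and> fst x = quot_ring (fst nF) (snd nF)" if "x \<in> Ob" for x
  proof -
    have "fst x \<in> fp_rings"
      using that objs(2) by (auto simp: elements_def)
    then show ?thesis
      by (auto simp: fp_rings_iff)
  qed
  then have "\<forall>x\<in>Ob. \<exists>nF. finite (snd nF) \<and> snd nF \<subseteq> carrier (zpoly_ring (fst nF))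
      \<and> fst x = quot_ring (fst nF) (snd nF)" ..
  from bchoice[OF this] obtain nF where nF: "\<And>x. x \<in> Ob \<Longrightarrow> finite (snd (nF x))"
      "\<And>x. x \<in> Ob \<Longrightarrow> snd (nF x) \<subseteq> carrier (zpoly_ring (fst (nF x)))"
      "\<And>x. x \<in> Ob \<Longrightarrow> fst x = quot_ring (fst (nF x)) (snd (nF x))"
    by blast
  define N where "N x = fst (nF x)" for x
  define F where "F x = snd (nF x)" for x
  define \<pi> where "\<pi> x = quot_proj (N x) (F x)" for x
  define gen where "gen x i = \<pi> x (zvar i)" for x i
  have F: "finite (F x)" "F x \<subseteq> carrier (zpoly_ring (N x))" and P: "fst x = quot_ring (N x) (F x)"
    if "x \<in> Ob" for x
    using nF that by (auto simp: N_def F_def)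
  have \<pi>: "\<pi> x \<in> ring_hom (zpoly_ring (N x)) (fst x)" if "x \<in> Ob" for x
    using quot_proj_hom[OF F(2)] P that by (simp add: \<pi>_def)
  have gen: "gen x i \<in> carrier (fst x)" if "x \<in> Ob" "i < N x" for x i
    using ring_hom_closed[OF \<pi>] that by (simp add: gen_def)
  have a: "snd x \<in> ring_hom (fst x) A" "snd x \<in> Hom (fst x) A" if "x \<in> Ob" for x
    using objs(2) that by (auto simp: elements_def Hom_def)

  define S where "S = (\<Union>x\<in>Ob. (\<lambda>i. snd x (gen x i)) ` {..<N x})"
  have S: "finite S" "S \<subseteq> carrier A"
    using objs(1) ring_hom_closed[OF a(1) gen] by (auto simp: S_def)
  obtain s where s: "bij_betw s {0..<card S} S"
    using ex_bij_betw_nat_finite[OF S(1)] by blast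
  \<comment> \<open>One variable for each element of \<open>S\<close>; the remaining ones only make the number of variables
    differ from that of every presentation in \<open>Ob\<close>, so that the new object is not in \<open>Ob\<close>.\<close>
  define M where "M = Suc (card S + (\<Sum>x\<in>Ob. N x))"
  define \<psi> where "\<psi> k = (if k < card S then s k else \<zero>\<^bsub>A\<^esub>)" for k
  have \<psi>: "\<psi> k \<in> carrier A" for k
    using bij_betwE[OF s] S(2) by (auto simp: \<psi>_def)
  obtain ev where ev: "ev \<in> ring_hom (zpoly_ring M) A" and ev_var: "\<And>k. k < M \<Longrightarrow> ev (zvar k) = \<psi> k"
    using zpoly_ring_hom_exists[OF A, of M \<psi>] \<psi> by blast

  \<comment> \<open>Only the value of the chosen variable matters. The choice depends on the value
    alone, so generators with equal values in \<open>A\<close> share a variable, also across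
    different objects.\<close>
  define \<rho> where "\<rho> x i = (SOME k. k < M \<and> \<psi> k = snd x (gen x i))" for x i
  have \<rho>: "\<rho> x i < M \<and> \<psi> (\<rho> x i) = snd x (gen x i)" if "x \<in> Ob" "i < N x" for x i
  proof -
    have "snd x (gen x i) \<in> s ` {0..<card S}"
      using that bij_betw_imp_surj_on[OF s] by (auto simp: S_def)
    then obtain k where "k < card S" "s k = snd x (gen x i)" by auto
    then have "k < M \<and> \<psi> k = snd x (gen x i)"
      by (simp add: M_def \<psi>_def)
    then show ?thesis
      unfolding \<rho>_def by (rule someI)
  qed
  \<comment> \<open>The future leg at \<open>x\<close> is first built between polynomial rings, as
    the renaming \<open>\<sigma> x\<close> of variables along \<open>\<rho> x\<close>.\<close>
  have "\<forall>x\<in>Ob. \<exists>h. h \<in> ring_hom (zpoly_ring (N x)) (zpoly_ring M) \<and> (\<forall>i<N x. h (zvar i) = zvar (\<rho> x i))"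
  proof
    fix x assume "x \<in> Ob"
    then show "\<exists>h. h \<in> ring_hom (zpoly_ring (N x)) (zpoly_ring M) \<and> (\<forall>i<N x. h (zvar i) = zvar (\<rho> x i))"
      using zpoly_ring_hom_exists[OF cring_zpoly_ring, of "N x" "\<lambda>i. zvar (\<rho> x i)" M] \<rho> by auto
  qed
  from bchoice[OF this] obtain \<sigma> where
    \<sigma>: "\<And>x. x \<in> Ob \<Longrightarrow> \<sigma> x \<in> ring_hom (zpoly_ring (N x)) (zpoly_ring M)"
      "\<And>x i. x \<in> Ob \<Longrightarrow> i < N x \<Longrightarrow> \<sigma> x (zvar i) = zvar (\<rho> x i)"
    by blast
  have ev_\<sigma>: "ev (\<sigma> x p) = snd x (\<pi> x p)" if x: "x \<in> Ob" and p: "p \<in> carrier (zpoly_ring (N x))" for x p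
  proof -
    have "(ev \<circ> \<sigma> x) p = (snd x \<circ> \<pi> x) p"
      using A.ring_axioms ring_hom_trans[OF \<sigma>(1)[OF x] ev] ring_hom_trans[OF \<pi>[OF x] a(1)[OF x]] _ p
      by (rule zpoly_ring_hom_eqI) (use x \<sigma>(2) ev_var \<rho> in \<open>simp add: gen_def\<close>)
    then show ?thesis by simp
  qed

  \<comment> \<open>An arrow \<open>v\<close> is a map of quotients; to state its commutation as a
    polynomial relation, the image of each generator needs a polynomial representative.\<close>
  have r_ex: "\<exists>r. r \<in> carrier (zpoly_ring (N y)) \<and> \<pi> y r = v (gen x i)"
    if g: "(x, v, y) \<in> Ar" and i: "i < N x" for x v y i
  proof -
    have xy: "x \<in> Ob" "y \<in> Ob" using arrs(3)[OF g] by auto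
    have "v \<in> ring_hom (fst x) (fst y)"
      using arrs(2) g by (auto simp: element_arrows_def Hom_def)
    then have "v (gen x i) \<in> carrier (quot_ring (N y) (F y))"
      using ring_hom_closed gen[OF xy(1) i] P[OF xy(2)] by metis
    then show ?thesis
      by (auto simp: carrier_quot_ring \<pi>_def)
  qed
  define r where "r = (\<lambda>(x, v, y) i. SOME r. r \<in> carrier (zpoly_ring (N y)) \<and> \<pi> y r = v (gen x i))"
  have r: "r (x, v, y) i \<in> carrier (zpoly_ring (N y)) \<and> \<pi> y (r (x, v, y) i) = v (gen x i)"
    if "(x, v, y) \<in> Ar" "i < N x" for x v y i
    using someI_ex[OF r_ex[OF that]] by (simp add: r_def)

  \<comment> \<open>The first union makes every \<open>\<sigma> x\<close> descend to the quotient;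
    the second forces the leg at \<open>y\<close> after \<open>v\<close> to agree with the leg at
    \<open>x\<close> on the generators of the source.\<close>
  define E where "E = (\<Union>x\<in>Ob. \<sigma> x ` F x) \<union>
    (\<Union>(x, v, y)\<in>Ar. (\<lambda>i. \<sigma> y (r (x, v, y) i) - zvar (\<rho> x i)) ` {..<N x})"
  have E_fin: "finite E"
    using objs(1) arrs(1) F(1) by (auto simp: E_def)
  have E: "e \<in> carrier (zpoly_ring M) \<and> ev e = \<zero>\<^bsub>A\<^esub>" if "e \<in> E" for e
    using that unfolding E_def
  proof (elim UnE UN_E imageE)
    fix x p assume x: "x \<in> Ob" and p: "p \<in> F x" "e = \<sigma> x p"
    then have p': "p \<in> carrier (zpoly_ring (N x))" using F(2) by blast
    have "\<pi> x p = \<zero>\<^bsub>fst x\<^esub>"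
      using quot_proj_eq_zero[OF F(2)[OF x] p(1)] P[OF x] by (simp add: \<pi>_def)
    then have "ev e = \<zero>\<^bsub>A\<^esub>"
      using ev_\<sigma>[OF x p'] p(2) ring_hom_zero[OF a(1)[OF x]] cring_fp_ring[THEN cring.axioms(1)]
        A.ring_axioms objs(2) x by (auto simp: elements_def)
    then show ?thesis
      using ring_hom_closed[OF \<sigma>(1)[OF x] p'] p(2) by simp
  next
    fix g assume g: "g \<in> Ar" and "e \<in> (case g of (x, v, y) \<Rightarrow>
        (\<lambda>i. \<sigma> y (r (x, v, y) i) - zvar (\<rho> x i)) ` {..<N x})"
    then obtain x v y i where g': "(x, v, y) \<in> Ar" and i: "i < N x"
      and e: "e = \<sigma> y (r (x, v, y) i) - zvar (\<rho> x i)"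
      by (cases g) auto
    have xy: "x \<in> Ob" "y \<in> Ob" using arrs(3)[OF g'] by auto
    note r' = r[OF g' i]
    have \<sigma>r: "\<sigma> y (r (x, v, y) i) \<in> carrier (zpoly_ring M)"
      using ring_hom_closed[OF \<sigma>(1)[OF xy(2)]] r' by blast
    have z: "zvar (\<rho> x i) \<in> carrier (zpoly_ring M)"
      using \<rho>[OF xy(1) i] by simp
    have "compose (carrier (fst x)) (snd y) v = snd x"
      using arrs(2) g' by (auto simp: element_arrows_def)
    then have "snd y (v (gen x i)) = snd x (gen x i)"
      using compose_eq[OF gen[OF xy(1) i]] by metis
    then have "ev (\<sigma> y (r (x, v, y) i)) = ev (zvar (\<rho> x i))"
      using ev_\<sigma>[OF xy(2)] r' \<rho>[OF xy(1) i] ev_var by simp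
    then have "ev e = \<zero>\<^bsub>A\<^esub>"
      using ring_hom_diff[OF ring_zpoly_ring A.ring_axioms ev \<sigma>r z] ring_hom_closed[OF ev z]
      by (simp add: zpoly_ring_minus[OF \<sigma>r z] e A.minus_eq A.r_neg)
    then show ?thesis
      using zpoly_ring_diff_closed[OF \<sigma>r z] e by simp
  qed
  then have E_sub: "E \<subseteq> carrier (zpoly_ring M)" by blast

  define Q where "Q = quot_ring M E"
  define \<pi>Q where "\<pi>Q = quot_proj M E"
  have Q: "Q \<in> fp_rings"
    using E_fin E_sub by (auto simp: fp_rings_iff Q_def)
  have Q_ring: "ring Q"
    using cring_fp_ring[OF Q] by (rule cring.axioms(1))
  have \<pi>Q: "\<pi>Q \<in> ring_hom (zpoly_ring M) Q"
    unfolding \<pi>Q_def Q_def by (rule quot_proj_hom[OF E_sub])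
  have \<pi>Q_E: "\<pi>Q e = \<zero>\<^bsub>Q\<^esub>" if "e \<in> E" for e
    unfolding \<pi>Q_def Q_def by (rule quot_proj_eq_zero[OF E_sub that])
  obtain b where b: "b \<in> Hom Q A" and b_eq: "\<And>p. p \<in> carrier (zpoly_ring M) \<Longrightarrow> b (\<pi>Q p) = ev p"
    using quot_ring_lift[OF E_sub A.ring_axioms ev] E unfolding Q_def \<pi>Q_def by blast
  have "\<forall>x\<in>Ob. \<exists>w. w \<in> Hom (fst x) Q \<and> (\<forall>p\<in>carrier (zpoly_ring (N x)). w (\<pi> x p) = \<pi>Q (\<sigma> x p))"
  proof
    fix x assume x: "x \<in> Ob"
    have h: "\<pi>Q \<circ> \<sigma> x \<in> ring_hom (zpoly_ring (N x)) Q"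
      by (rule ring_hom_trans[OF \<sigma>(1)[OF x] \<pi>Q])
    have "(\<pi>Q \<circ> \<sigma> x) p = \<zero>\<^bsub>Q\<^esub>" if "p \<in> F x" for p
      using x that \<pi>Q_E by (auto simp: E_def)
    from quot_ring_lift[OF F(2)[OF x] Q_ring h this] P[OF x]
    show "\<exists>w. w \<in> Hom (fst x) Q \<and> (\<forall>p\<in>carrier (zpoly_ring (N x)). w (\<pi> x p) = \<pi>Q (\<sigma> x p))"
      unfolding \<pi>_def by (metis comp_apply)
  qed
  from bchoice[OF this] obtain u where u: "\<And>x. x \<in> Ob \<Longrightarrow> u x \<in> Hom (fst x) Q"
    and u_eq: "\<And>x p. x \<in> Ob \<Longrightarrow> p \<in> carrier (zpoly_ring (N x)) \<Longrightarrow> u x (\<pi> x p) = \<pi>Q (\<sigma> x p)"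
    by blast
  have P_ring: "ring (fst x)" if "x \<in> Ob" for x
    using cring_quot_ring[OF F(2)] P that by (simp add: cring.axioms(1))
  have Hom_eqI: "f = g" if "x \<in> Ob" "ring R" "f \<in> Hom (fst x) R" "g \<in> Hom (fst x) R"
      "\<And>i. i < N x \<Longrightarrow> f (gen x i) = g (gen x i)" for x f g and R :: "('r, 's) ring_scheme"
    using Hom_quot_ring_eqI[OF F(2) \<open>ring R\<close>] that P unfolding gen_def \<pi>_def by metis

  show thesis
  proof (rule that)
    show "(Q, b) \<in> elements A"
      using Q b by (simp add: elements_def)
    show "(Q, b) \<notin> Ob"
    proof
      assume x: "(Q, b) \<in> Ob"
      then have "N (Q, b) = M"
        using quot_ring_eq_imp_eq[OF F(2) E_sub] P[OF x] by (simp add: Q_def)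
      moreover have "N (Q, b) \<le> (\<Sum>x\<in>Ob. N x)"
        using x objs(1) by (intro member_le_sum) auto
      ultimately show False by (simp add: M_def)
    qed
    show "u x \<in> Hom (fst x) Q" if "x \<in> Ob" for x
      by (rule u[OF that])
    show "compose (carrier (fst x)) b (u x) = snd x" if x: "x \<in> Ob" for x
    proof (rule Hom_eqI[OF x A.ring_axioms])
      show "compose (carrier (fst x)) b (u x) \<in> Hom (fst x) A"
        by (rule Hom_compose[OF P_ring[OF x] u[OF x] b])
      fix i assume i: "i < N x"
      have "b (u x (gen x i)) = ev (\<sigma> x (zvar i))"
        unfolding gen_def using i x u_eq b_eq ring_hom_closed[OF \<sigma>(1)[OF x]] by simp
      then show "compose (carrier (fst x)) b (u x) (gen x i) = snd x (gen x i)"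
        using ev_\<sigma>[OF x] i unfolding compose_eq[OF gen[OF x i]] by (simp add: gen_def)
    qed (rule a(2)[OF x])
    show "compose (carrier (fst x)) (u y) v = u x" if g: "(x, v, y) \<in> Ar" for x v y
    proof -
      have xy: "x \<in> Ob" "y \<in> Ob" using arrs(3)[OF g] by auto
      have v: "v \<in> Hom (fst x) (fst y)"
        using arrs(2) g by (auto simp: element_arrows_def)
      show ?thesis
      proof (rule Hom_eqI[OF xy(1) Q_ring])
        show "compose (carrier (fst x)) (u y) v \<in> Hom (fst x) Q"
          by (rule Hom_compose[OF P_ring[OF xy(1)] v u[OF xy(2)]])
        fix i assume i: "i < N x"
        note r' = r[OF g i]
        have \<sigma>r: "\<sigma> y (r (x, v, y) i) \<in> carrier (zpoly_ring M)"
          using ring_hom_closed[OF \<sigma>(1)[OF xy(2)]] r' by blast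
        have z: "zvar (\<rho> x i) \<in> carrier (zpoly_ring M)"
          using \<rho>[OF xy(1) i] by simp
        \<comment> \<open>This is the relation imposed for the arrow and the generator
          \<open>i\<close>; it identifies the two images in \<open>Q\<close>.\<close>
        have e: "\<sigma> y (r (x, v, y) i) - zvar (\<rho> x i) \<in> E"
          using g i unfolding E_def by blast
        have "u y (v (gen x i)) = \<pi>Q (\<sigma> y (r (x, v, y) i))"
          using r' u_eq[OF xy(2)] by metis
        also have "\<dots> = \<pi>Q (zvar (\<rho> x i))"
          unfolding \<pi>Q_def quot_proj_eq_iff[OF E_sub \<sigma>r z]
          using ring.genideal_self[OF ring_zpoly_ring E_sub] e by blast
        also have "\<dots> = u x (gen x i)"
          using u_eq[OF xy(1), of "zvar i"] \<sigma>(2)[OF xy(1) i] i by (simp add: gen_def)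
        finally show "compose (carrier (fst x)) (u y) v (gen x i) = u x (gen x i)"
          by (simp add: compose_eq[OF gen[OF xy(1) i]])
      qed (rule u[OF xy(1)])
    qed
  qed
qed

text \<open>Identities and legs are already closed under composition: every leg ends at the apex,
  and no leg starts there because \<open>(Q, b)\<close> is not in \<open>Ob\<close>. So no
  composable pair consists of two legs, and the star stays finite.\<close>

lemma finite_subcategory_star:
  assumes Ob: "finite Ob" "Ob \<subseteq> elements A" and z: "(Q, b) \<in> elements A" "(Q, b) \<notin> Ob"
    and u: "\<And>x. x \<in> Ob \<Longrightarrow> u x \<in> Hom (fst x) Q"
      "\<And>x. x \<in> Ob \<Longrightarrow> compose (carrier (fst x)) b (u x) = snd x"
  shows "finite_subcategory A (insert (Q, b) Ob)
    ((\<lambda>x. (x, restrict id (carrier (fst x)), x)) ` insert (Q, b) Ob \<union> (\<lambda>x. (x, u x, (Q, b))) ` Ob)"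
proof -
  have id: "(x, restrict id (carrier (fst x)), x) \<in> element_arrows A" if x_el: "x \<in> elements A" for x
  proof -
    obtain P a where x: "x = (P, a)" "a \<in> Hom P A" "P \<in> fp_rings"
      using x_el by (auto simp: elements_def)
    have "restrict id (carrier P) \<in> Hom P P"
      using cring_fp_ring[OF x(3)] unfolding Hom_def
      by (auto simp: ring_hom_def cring_def ring.ring_simprules monoid.one_closed monoid.m_closed ring_def)
    moreover have "compose (carrier P) a (restrict id (carrier P)) = a"
      using x(2) by (auto simp: Hom_def compose_def extensional_def restrict_def fun_eq_iff)
    ultimately show ?thesis
      using x_el x by (auto simp: element_arrows_def)
  qed
  have arr: "(x, u x, (Q, b)) \<in> element_arrows A" if "x \<in> Ob" for x
    using that u Ob(2) z(1) by (cases x) (fastforce simp: element_arrows_def)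
  have comp_id: "compose (carrier (fst x)) f (restrict id (carrier (fst x))) = f"
    if "f \<in> Hom (fst x) R" for x :: "'a el" and f and R :: fpring
    using that by (auto simp: Hom_def compose_def extensional_def restrict_def fun_eq_iff)
  have id_comp: "compose (carrier P) (restrict id (carrier R)) f = f"
    if "f \<in> Hom P R" for f and P R :: fpring
    using that by (auto simp: Hom_def compose_def extensional_def ring_hom_def Pi_iff restrict_def fun_eq_iff)
  have id_id: "compose (carrier P) (restrict id (carrier P)) (restrict id (carrier P)) = restrict id (carrier P)"
    for P :: fpring
    by (auto simp: compose_def restrict_def fun_eq_iff)
  let ?I1 = "(\<lambda>x. (x, restrict id (carrier (fst x)), x)) ` insert (Q, b) Ob \<union> (\<lambda>x. (x, u x, (Q, b))) ` Ob"
  have I1: "x \<in> insert (Q, b) Ob \<and> v = restrict id (carrier (fst x)) \<and> y = x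
      \<or> x \<in> Ob \<and> v = u x \<and> y = (Q, b)"
    if "(x, v, y) \<in> ?I1" for x v y
    using that by auto
  have closed: "(x, compose (carrier (fst x)) w v, y') \<in> ?I1"
    if "(x, v, y) \<in> ?I1" "(y, w, y') \<in> ?I1" for x v y w y'
    using I1[OF that(1)]
  proof (elim disjE conjE)
    assume x: "x \<in> insert (Q, b) Ob" "v = restrict id (carrier (fst x))" "y = x"
    show ?thesis
      using I1[OF that(2)] that(2) x id_id comp_id[OF u(1)] by auto
  next
    \<comment> \<open>After a leg, the only arrow available is the identity of the apex.\<close>
    assume x: "x \<in> Ob" "v = u x" "y = (Q, b)"
    then have "w = restrict id (carrier Q)" "y' = (Q, b)"
      using I1[OF that(2)] z(2) by auto
    then show ?thesis
      using x id_comp[OF u(1)[OF x(1)]] by simp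
  qed
  show ?thesis
    unfolding finite_subcategory_def
  proof (intro conjI allI impI)
    fix x v y w y' assume "(x, v, y) \<in> ?I1 \<and> (y, w, y') \<in> ?I1"
    then show "(x, compose (carrier (fst x)) w v, y') \<in> ?I1"
      by (elim conjE) (rule closed)
  next
    show "?I1 \<subseteq> element_arrows A"
      by (intro Un_least image_subsetI id arr) (use Ob(2) z(1) in blast)
  next
    fix x v y assume "(x, v, y) \<in> ?I1"
    then show "x \<in> insert (Q, b) Ob" "y \<in> insert (Q, b) Ob"
      by (auto dest!: I1)
  qed (use Ob z in auto)
qed

section \<open>Ultrafilters\<close>

text \<open>Zorn's lemma gives a maximal filter containing \<open>K\<close>. If it contained neither
  \<open>S\<close> nor its complement, adjoining \<open>S\<close> would enlarge it.\<close>

lemma ultrafilter_on_exists: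
  assumes K: "K \<subseteq> Pow J" "K \<noteq> {}" "{} \<notin> K" "\<And>S T. S \<in> K \<Longrightarrow> T \<in> K \<Longrightarrow> S \<inter> T \<in> K"
  obtains U where "ultrafilter_on J U" "K \<subseteq> U"
proof -
  define filt where "filt V \<longleftrightarrow> K \<subseteq> V \<and> V \<subseteq> Pow J \<and> {} \<notin> V
    \<and> (\<forall>S T. S \<in> V \<and> S \<subseteq> T \<and> T \<subseteq> J \<longrightarrow> T \<in> V) \<and> (\<forall>S\<in>V. \<forall>T\<in>V. S \<inter> T \<in> V)" for V
  have filt_Int: "S \<inter> T \<in> V" if "filt V" "S \<in> V" "T \<in> V" for S T V
    using that by (simp add: filt_def)
  have filt_up: "T \<in> V" if "filt V" "S \<in> V" "S \<subseteq> T" "T \<subseteq> J" for S T V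
    using that unfolding filt_def by metis
  have filt_sub: "K \<subseteq> V" "V \<subseteq> Pow J" "{} \<notin> V" if "filt V" for V
    using that by (simp_all add: filt_def)
  \<comment> \<open>The filter generated by a base is needed twice: for \<open>K\<close> itself, to
    have a filter to start from, and for the maximal filter with \<open>S\<close> adjoined.\<close>
  have filt_gen: "filt {T. T \<subseteq> J \<and> (\<exists>S\<in>L. S \<subseteq> T)}"
    if L: "K \<subseteq> L" "L \<subseteq> Pow J" "{} \<notin> L" "\<And>S T. S \<in> L \<Longrightarrow> T \<in> L \<Longrightarrow> S \<inter> T \<in> L" for L
    unfolding filt_def
  proof (intro conjI ballI allI impI)
    show "K \<subseteq> {T. T \<subseteq> J \<and> (\<exists>S\<in>L. S \<subseteq> T)}" "{} \<notin> {T. T \<subseteq> J \<and> (\<exists>S\<in>L. S \<subseteq> T)}"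
      using L(1-3) K(1) by auto
    fix S T assume "S \<in> {T. T \<subseteq> J \<and> (\<exists>S\<in>L. S \<subseteq> T)} \<and> S \<subseteq> T \<and> T \<subseteq> J"
    then show "T \<in> {T. T \<subseteq> J \<and> (\<exists>S\<in>L. S \<subseteq> T)}" by auto
  next
    fix S T assume "S \<in> {T. T \<subseteq> J \<and> (\<exists>S\<in>L. S \<subseteq> T)}" "T \<in> {T. T \<subseteq> J \<and> (\<exists>S\<in>L. S \<subseteq> T)}"
    then obtain S' T' where "S' \<in> L" "T' \<in> L" "S' \<subseteq> S" "T' \<subseteq> T" "S \<subseteq> J" by blast
    then show "S \<inter> T \<in> {T. T \<subseteq> J \<and> (\<exists>S\<in>L. S \<subseteq> T)}"
      using L(4)[of S' T'] by blast
  qed auto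
  have "\<exists>U\<in>Collect filt. \<forall>V\<in>Collect filt. U \<subseteq> V \<longrightarrow> V = U"
  proof (rule subset_Zorn_nonempty)
    show "Collect filt \<noteq> {}"
      using filt_gen[of K] K by blast
    fix \<C> assume ne: "\<C> \<noteq> {}" and ch: "subset.chain (Collect filt) \<C>"
    have filt: "filt V" if "V \<in> \<C>" for V
      using ch that by (auto simp: subset.chain_def)
    have "S \<inter> T \<in> \<Union>\<C>" if "S \<in> \<Union>\<C>" "T \<in> \<Union>\<C>" for S T
    proof -
      obtain V W where VW: "V \<in> \<C>" "W \<in> \<C>" "S \<in> V" "T \<in> W" using \<open>S \<in> \<Union>\<C>\<close> \<open>T \<in> \<Union>\<C>\<close> by blast
      then have "V \<subseteq> W \<or> W \<subseteq> V"
        using ch by (auto simp: subset_chain_def)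
      then show ?thesis
      proof
        assume "V \<subseteq> W"
        then have "S \<in> W" using VW(3) by blast
        then show ?thesis using filt_Int[OF filt _ VW(4)] VW(2) by blast
      next
        assume "W \<subseteq> V"
        then have "T \<in> V" using VW(4) by blast
        then show ?thesis using filt_Int[OF filt VW(3)] VW(1) by blast
      qed
    qed
    moreover have "K \<subseteq> \<Union>\<C>"
      using ne filt_sub(1)[OF filt] by blast
    moreover have "\<Union>\<C> \<subseteq> Pow J" "{} \<notin> \<Union>\<C>"
      using filt_sub(2,3)[OF filt] by blast+
    moreover have "\<forall>S T. S \<in> \<Union>\<C> \<and> S \<subseteq> T \<and> T \<subseteq> J \<longrightarrow> T \<in> \<Union>\<C>"
      using filt_up[OF filt] by blast
    ultimately show "\<Union>\<C> \<in> Collect filt"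
      unfolding filt_def mem_Collect_eq by (intro conjI ballI)
  qed
  then obtain U where U: "filt U" and max: "\<And>V. filt V \<Longrightarrow> U \<subseteq> V \<Longrightarrow> V = U"
    by blast
  note up = filt_up[OF U] and int = filt_Int[OF U] and sub = filt_sub(2,3,1)[OF U]
  have "S \<in> U \<or> J - S \<in> U" if S: "S \<subseteq> J" for S
  proof (cases "\<exists>T\<in>U. T \<inter> S = {}")
    case True
    then obtain T where "T \<in> U" "T \<inter> S = {}" by blast
    then have "J - S \<in> U" using up[of T "J - S"] sub(1) by blast
    then show ?thesis ..
  next
    case False
    \<comment> \<open>No member of \<open>U\<close> is disjoint from \<open>S\<close> in this case,
      so adding the traces on \<open>S\<close> gives a filter base without the empty set; maximality
      then puts \<open>S\<close> into \<open>U\<close>.\<close>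
    define L where "L = U \<union> {T \<inter> S | T. T \<in> U}"
    define V where "V = {T. T \<subseteq> J \<and> (\<exists>S\<in>L. S \<subseteq> T)}"
    have LI: "T \<in> L" "T \<inter> S \<in> L" if "T \<in> U" for T
      using that by (auto simp: L_def)
    have "filt V"
      unfolding V_def
    proof (rule filt_gen)
      show "K \<subseteq> L" "L \<subseteq> Pow J" "{} \<notin> L"
        using sub False by (auto simp: L_def)
      fix X Y assume "X \<in> L" "Y \<in> L"
      then obtain X' Y' where X': "X' \<in> U" "X = X' \<or> X = X' \<inter> S" and Y': "Y' \<in> U" "Y = Y' \<or> Y = Y' \<inter> S"
        unfolding L_def by blast
      have "X \<inter> Y = X' \<inter> Y' \<or> X \<inter> Y = (X' \<inter> Y') \<inter> S"
        using X'(2) Y'(2) by blast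
      then show "X \<inter> Y \<in> L"
        using LI[OF int[OF X'(1) Y'(1)]] by auto
    qed
    moreover have "U \<subseteq> V"
      using sub(1) by (auto simp: V_def L_def)
    ultimately have "V = U" by (rule max)
    moreover have "S \<in> V"
    proof -
      obtain T where "T \<in> U" using K(2) sub(3) by blast
      then show ?thesis using LI(2)[of T] S by (auto simp: V_def)
    qed
    ultimately show ?thesis by blast
  qed
  moreover have "J \<in> U"
  proof -
    obtain T where "T \<in> K" using K(2) by blast
    then show ?thesis using up[of T J] K(1) sub(3) by blast
  qed
  ultimately have "ultrafilter_on J U"
    unfolding ultrafilter_on_def using sub(1,2) up int by (intro conjI allI impI ballI) auto
  then show ?thesis using that sub(3) by blast
qed

section \<open>Ultraproducts of commutative rings\<close>

locale cring_ultraproduct =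
  fixes J :: "'j set" and U :: "'j set set" and Bs :: "'j \<Rightarrow> 'b ring"
  assumes ultrafilter: "ultrafilter_on J U"
    and cring: "\<And>j. j \<in> J \<Longrightarrow> cring (Bs j)"
begin

lemma J_in_U [simp]: "J \<in> U"
  and U_subset: "S \<in> U \<Longrightarrow> S \<subseteq> J"
  and U_mono: "S \<in> U \<Longrightarrow> S \<subseteq> T \<Longrightarrow> T \<subseteq> J \<Longrightarrow> T \<in> U"
  and U_Int: "S \<in> U \<Longrightarrow> T \<in> U \<Longrightarrow> S \<inter> T \<in> U"
  and empty_notin_U: "{} \<notin> U"
  using ultrafilter unfolding ultrafilter_on_def by blast+

text \<open>The intersection is taken inside \<open>J\<close>, so that the empty family yields
  \<open>J\<close>, a member of \<open>U\<close>.\<close>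

lemma U_INT:
  assumes "finite I" "\<And>i. i \<in> I \<Longrightarrow> S i \<in> U"
  shows "{j \<in> J. \<forall>i\<in>I. j \<in> S i} \<in> U"
  using assms
proof (induction I rule: finite_induct)
  case (insert i I)
  have "{j \<in> J. \<forall>i\<in>insert i I. j \<in> S i} = S i \<inter> {j \<in> J. \<forall>i\<in>I. j \<in> S i}"
    using U_subset[OF insert.prems, of i] by auto
  then show ?case
    using insert by (simp add: U_Int)
qed simp

abbreviation UP :: "('j set \<times> ('j \<Rightarrow> 'b)) set ring"
  where "UP \<equiv> ultraproduct U Bs"

abbreviation eventually_eq :: "('j set \<times> ('j \<Rightarrow> 'b)) rel"
  where "eventually_eq \<equiv> colim_rel U (\<lambda>S T. T \<subseteq> S) (\<lambda>S. product_ring S Bs) (\<lambda>S T x. restrict x T)"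

text \<open>The germ of \<open>g\<close> along \<open>U\<close>, written as the class of all partial
  families that agree with \<open>g\<close> almost everywhere. Here \<open>g\<close> is any total
  function, and its values may leave the carriers; this frees later computations from choosing
  stages and restrictions.\<close>

definition cls :: "('j \<Rightarrow> 'b) \<Rightarrow> ('j set \<times> ('j \<Rightarrow> 'b)) set"
  where "cls g = {(S, x). S \<in> U \<and> x \<in> carrier (product_ring S Bs) \<and> {j \<in> S. x j = g j} \<in> U}"

lemma carrier_product_ring: "carrier (product_ring S Bs) = (\<Pi>\<^sub>E j\<in>S. carrier (Bs j))"
  by (simp add: product_ring_def)

lemma product_ring_simps:
  "x \<otimes>\<^bsub>product_ring S Bs\<^esub> y = (\<lambda>j\<in>S. x j \<otimes>\<^bsub>Bs j\<^esub> y j)"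
  "x \<oplus>\<^bsub>product_ring S Bs\<^esub> y = (\<lambda>j\<in>S. x j \<oplus>\<^bsub>Bs j\<^esub> y j)"
  "\<one>\<^bsub>product_ring S Bs\<^esub> = (\<lambda>j\<in>S. \<one>\<^bsub>Bs j\<^esub>)"
  "\<zero>\<^bsub>product_ring S Bs\<^esub> = (\<lambda>j\<in>S. \<zero>\<^bsub>Bs j\<^esub>)"
  by (simp_all add: product_ring_def)

text \<open>Pairs identified at a stage \<open>R\<close> coincide on \<open>R\<close>, so agreement
  with \<open>g\<close> almost everywhere passes from one to the other. Conversely, two pairs that
  agree with \<open>g\<close> are identified at the intersection of their agreement sets.\<close>

lemma eventually_eq_Image:
  assumes S: "S \<in> U" and x: "x \<in> carrier (product_ring S Bs)" and g: "{j \<in> S. x j = g j} \<in> U"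
  shows "eventually_eq `` {(S, x)} = cls g"
proof (rule Set.set_eqI)
  fix q :: "'j set \<times> ('j \<Rightarrow> 'b)"
  obtain T y where q: "q = (T, y)" by (cases q)
  show "q \<in> eventually_eq `` {(S, x)} \<longleftrightarrow> q \<in> cls g"
  proof
    assume "q \<in> eventually_eq `` {(S, x)}"
    then obtain R where R: "R \<in> U" "R \<subseteq> S" "R \<subseteq> T" "restrict x R = restrict y R"
      and T: "T \<in> U" "y \<in> carrier (product_ring T Bs)"
      by (auto simp: q colim_rel_def)
    have "y j = g j" if "j \<in> R" "x j = g j" for j
      using R(4) that by (metis restrict_apply')
    then have "R \<inter> {j \<in> S. x j = g j} \<subseteq> {j \<in> T. y j = g j}"
      using R(3) by auto
    then have "{j \<in> T. y j = g j} \<in> U"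
      using U_mono[OF U_Int[OF R(1) g]] U_subset[OF T(1)] by blast
    then show "q \<in> cls g"
      using T by (simp add: q cls_def)
  next
    assume "q \<in> cls g"
    then have T: "T \<in> U" "y \<in> carrier (product_ring T Bs)" "{j \<in> T. y j = g j} \<in> U"
      by (auto simp: q cls_def)
    let ?R = "{j \<in> S. x j = g j} \<inter> {j \<in> T. y j = g j}"
    have "?R \<in> U" using U_Int[OF g T(3)] .
    moreover have "restrict x ?R = restrict y ?R" by (auto simp: restrict_def)
    ultimately show "q \<in> eventually_eq `` {(S, x)}"
      using S x T by (auto simp: q colim_rel_def intro!: bexI[of _ ?R])
  qed
qed

lemma restrict_in_cls:
  assumes "S \<in> U" "\<And>j. j \<in> S \<Longrightarrow> g j \<in> carrier (Bs j)"
  shows "(S, restrict g S) \<in> cls g"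
  using assms by (auto simp: cls_def carrier_product_ring)

text \<open>The hypothesis supplies a representative of \<open>cls g\<close>. If \<open>g\<close>
  were outside the carriers on too large a set, \<open>cls g\<close> would be empty, and equality of
  classes would say nothing about agreement.\<close>

lemma cls_eq_iff:
  assumes "{j \<in> J. g j \<in> carrier (Bs j)} \<in> U"
  shows "cls g = cls h \<longleftrightarrow> {j \<in> J. g j = h j} \<in> U"
proof
  let ?S = "{j \<in> J. g j \<in> carrier (Bs j)}"
  assume "cls g = cls h"
  moreover have "(?S, restrict g ?S) \<in> cls g"
    using assms by (intro restrict_in_cls) auto
  ultimately have "{j \<in> ?S. restrict g ?S j = h j} \<in> U"
    by (auto simp: cls_def)
  then show "{j \<in> J. g j = h j} \<in> U"
    by (rule U_mono) auto
next
  assume eq: "{j \<in> J. g j = h j} \<in> U"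
  have "{j \<in> S. x j = g j} \<in> U \<longleftrightarrow> {j \<in> S. x j = h j} \<in> U" if "S \<in> U" for S x
  proof
    assume "{j \<in> S. x j = g j} \<in> U"
    from U_Int[OF this eq] show "{j \<in> S. x j = h j} \<in> U"
      by (rule U_mono) (use U_subset[OF that] in auto)
  next
    assume "{j \<in> S. x j = h j} \<in> U"
    from U_Int[OF this eq] show "{j \<in> S. x j = g j} \<in> U"
      by (rule U_mono) (use U_subset[OF that] in auto)
  qed
  then show "cls g = cls h"
    by (auto simp: cls_def)
qed

lemma cls_closed:
  assumes "{j \<in> J. g j \<in> carrier (Bs j)} \<in> U"
  shows "cls g \<in> carrier UP"
proof -
  let ?S = "{j \<in> J. g j \<in> carrier (Bs j)}"
  have "{j \<in> ?S. restrict g ?S j = g j} = ?S"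
    by auto
  then have "eventually_eq `` {(?S, restrict g ?S)} = cls g"
    using assms by (intro eventually_eq_Image) (auto simp: carrier_product_ring)
  moreover have "(?S, restrict g ?S) \<in> (SIGMA S:U. carrier (product_ring S Bs))"
    using assms by (auto simp: carrier_product_ring)
  ultimately show ?thesis
    unfolding ultraproduct_def directed_colimit_def Let_def
    by (auto simp: quotient_def)
qed

text \<open>A family over \<open>S\<close> is extended by zero to \<open>J\<close> without changing
  its class. Hence the ultraproduct is a quotient of the full product.\<close>

lemma UP_carrierE:
  assumes "p \<in> carrier UP"
  obtains g where "g \<in> carrier (product_ring J Bs)" "p = cls g"
proof -
  obtain S x where S: "S \<in> U" "x \<in> carrier (product_ring S Bs)" "p = eventually_eq `` {(S, x)}"
    using assms unfolding ultraproduct_def directed_colimit_def Let_def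
    by (auto simp: quotient_def)
  define g where "g = (\<lambda>j\<in>J. if j \<in> S then x j else \<zero>\<^bsub>Bs j\<^esub>)"
  have "g \<in> carrier (product_ring J Bs)"
    using S(2) cring by (auto simp: g_def carrier_product_ring cring.cring_simprules(2) PiE_iff)
  moreover have "{j \<in> S. x j = g j} = S"
    using U_subset[OF S(1)] by (auto simp: g_def)
  then have "p = cls g"
    using S eventually_eq_Image[of S x g] by simp
  ultimately show thesis by (rule that)
qed

lemma product_ring_evI: "g \<in> carrier (product_ring J Bs) \<Longrightarrow> {j \<in> J. g j \<in> carrier (Bs j)} \<in> U"
  by (rule U_mono[OF J_in_U]) (auto simp: carrier_product_ring)

text \<open>Addition and multiplication of the directed colimit are handled together, with
  \<open>f\<close> as the operation in the factors. All classes in the union are the germ of the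
  pointwise result, and the domain where both \<open>g\<close> and \<open>h\<close> take values in
  the carriers shows that the union is not over an empty family.\<close>

lemma cls_op:
  assumes g: "{j \<in> J. g j \<in> carrier (Bs j)} \<in> U" and h: "{j \<in> J. h j \<in> carrier (Bs j)} \<in> U"
    and closed: "\<And>j a b. j \<in> J \<Longrightarrow> a \<in> carrier (Bs j) \<Longrightarrow> b \<in> carrier (Bs j) \<Longrightarrow> f j a b \<in> carrier (Bs j)"
  shows "\<Union>{eventually_eq `` {(R, \<lambda>j\<in>R. f j (restrict x R j) (restrict y R j))} | S x T y R.
      (S, x) \<in> cls g \<and> (T, y) \<in> cls h \<and> R \<in> U \<and> R \<subseteq> S \<and> R \<subseteq> T} = cls (\<lambda>j. f j (g j) (h j))"
    (is "\<Union>?M = _")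
proof -
  have "eventually_eq `` {(R, \<lambda>j\<in>R. f j (restrict x R j) (restrict y R j))} = cls (\<lambda>j. f j (g j) (h j))"
    if xy: "(S, x) \<in> cls g" "(T, y) \<in> cls h" and R: "R \<in> U" "R \<subseteq> S" "R \<subseteq> T" for S x T y R
  proof (rule eventually_eq_Image[OF R(1)])
    have "x j \<in> carrier (Bs j)" "y j \<in> carrier (Bs j)" "j \<in> J" if "j \<in> R" for j
      using xy R U_subset[OF R(1)] that by (auto simp: cls_def carrier_product_ring)
    then show "(\<lambda>j\<in>R. f j (restrict x R j) (restrict y R j)) \<in> carrier (product_ring R Bs)"
      using closed by (auto simp: carrier_product_ring)
    have "R \<inter> ({j \<in> S. x j = g j} \<inter> {j \<in> T. y j = h j}) \<in> U"
      using xy R by (intro U_Int) (auto simp: cls_def)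
    then show "{j \<in> R. (\<lambda>j\<in>R. f j (restrict x R j) (restrict y R j)) j = f j (g j) (h j)} \<in> U"
      by (rule U_mono) (use U_subset[OF R(1)] in auto)
  qed
  then have "?M \<subseteq> {cls (\<lambda>j. f j (g j) (h j))}" by blast
  moreover have "?M \<noteq> {}"
  proof -
    let ?R = "{j \<in> J. g j \<in> carrier (Bs j)} \<inter> {j \<in> J. h j \<in> carrier (Bs j)}"
    have "?R \<in> U" using U_Int[OF g h] .
    moreover have "(?R, restrict g ?R) \<in> cls g" "(?R, restrict h ?R) \<in> cls h"
      using \<open>?R \<in> U\<close> by (auto intro!: restrict_in_cls)
    ultimately show ?thesis by blast
  qed
  ultimately have "?M = {cls (\<lambda>j. f j (g j) (h j))}" by blast
  then show ?thesis by simp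
qed

lemma cls_mult:
  assumes "{j \<in> J. g j \<in> carrier (Bs j)} \<in> U" "{j \<in> J. h j \<in> carrier (Bs j)} \<in> U"
  shows "cls g \<otimes>\<^bsub>UP\<^esub> cls h = cls (\<lambda>j. g j \<otimes>\<^bsub>Bs j\<^esub> h j)"
  using cls_op[OF assms, of "\<lambda>j. (\<otimes>\<^bsub>Bs j\<^esub>)"] cring
  by (simp add: ultraproduct_def directed_colimit_def Let_def product_ring_simps
      cring.cring_simprules conj_assoc)

lemma cls_add:
  assumes "{j \<in> J. g j \<in> carrier (Bs j)} \<in> U" "{j \<in> J. h j \<in> carrier (Bs j)} \<in> U"
  shows "cls g \<oplus>\<^bsub>UP\<^esub> cls h = cls (\<lambda>j. g j \<oplus>\<^bsub>Bs j\<^esub> h j)"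
  using cls_op[OF assms, of "\<lambda>j. (\<oplus>\<^bsub>Bs j\<^esub>)"] cring
  by (simp add: ultraproduct_def directed_colimit_def Let_def product_ring_simps
      cring.cring_simprules conj_assoc)

lemma cls_const:
  assumes "\<And>j. j \<in> J \<Longrightarrow> c j \<in> carrier (Bs j)"
  shows "(\<Union>S\<in>U. eventually_eq `` {(S, \<lambda>j\<in>S. c j)}) = cls c"
proof -
  have "eventually_eq `` {(S, \<lambda>j\<in>S. c j)} = cls c" if "S \<in> U" for S
    using that assms U_subset[OF that]
    by (intro eventually_eq_Image) (auto simp: carrier_product_ring)
  then show ?thesis
    using J_in_U by blast
qed

lemma cls_one: "\<one>\<^bsub>UP\<^esub> = cls (\<lambda>j. \<one>\<^bsub>Bs j\<^esub>)"
  and cls_zero: "\<zero>\<^bsub>UP\<^esub> = cls (\<lambda>j. \<zero>\<^bsub>Bs j\<^esub>)"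
  using cls_const[of "\<lambda>j. \<one>\<^bsub>Bs j\<^esub>"] cls_const[of "\<lambda>j. \<zero>\<^bsub>Bs j\<^esub>"] cring
  by (simp_all add: ultraproduct_def directed_colimit_def Let_def product_ring_simps
      cring.cring_simprules)

lemma cring_product_ring: "cring (product_ring J Bs)"
proof (rule cringI)
  note simps = product_ring_simps carrier_product_ring cring.cring_simprules[OF cring] PiE_iff extensional_def
  show "abelian_group (product_ring J Bs)"
  proof (rule abelian_groupI)
    fix x assume x: "x \<in> carrier (product_ring J Bs)"
    show "\<exists>y\<in>carrier (product_ring J Bs). y \<oplus>\<^bsub>product_ring J Bs\<^esub> x = \<zero>\<^bsub>product_ring J Bs\<^esub>"
      using x by (intro bexI[of _ "\<lambda>j\<in>J. \<ominus>\<^bsub>Bs j\<^esub> x j"]) (auto simp: simps)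
  qed (auto simp: simps fun_eq_iff)
  have r_one: "a \<otimes>\<^bsub>Bs j\<^esub> \<one>\<^bsub>Bs j\<^esub> = a" if "j \<in> J" "a \<in> carrier (Bs j)" for j a
    using cring[OF that(1)] that(2) by (metis cring.cring_simprules(6,12,14))
  show "comm_monoid (product_ring J Bs)"
    by (rule comm_monoidI) (auto simp: simps r_one fun_eq_iff)
qed (auto simp: product_ring_simps carrier_product_ring cring.cring_simprules[OF cring] PiE_iff)

lemma cls_hom: "cls \<in> ring_hom (product_ring J Bs) UP"
proof (rule ring_hom_memI)
  have cong: "cls g = cls h" if "\<And>j. j \<in> J \<Longrightarrow> g j \<in> carrier (Bs j)" "\<And>j. j \<in> J \<Longrightarrow> g j = h j" for g h
    using that by (subst cls_eq_iff) (auto intro: U_mono[OF J_in_U])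
  note simps = product_ring_simps cring.cring_simprules[OF cring] carrier_product_ring PiE_iff
  fix g h assume gh: "g \<in> carrier (product_ring J Bs)" "h \<in> carrier (product_ring J Bs)"
  show "cls g \<in> carrier UP"
    by (rule cls_closed[OF product_ring_evI[OF gh(1)]])
  show "cls (g \<otimes>\<^bsub>product_ring J Bs\<^esub> h) = cls g \<otimes>\<^bsub>UP\<^esub> cls h"
    unfolding cls_mult[OF gh[THEN product_ring_evI]]
    by (rule cong) (use gh in \<open>auto simp: simps\<close>)
  show "cls (g \<oplus>\<^bsub>product_ring J Bs\<^esub> h) = cls g \<oplus>\<^bsub>UP\<^esub> cls h"
    unfolding cls_add[OF gh[THEN product_ring_evI]]
    by (rule cong) (use gh in \<open>auto simp: simps\<close>)
next
  show "cls \<one>\<^bsub>product_ring J Bs\<^esub> = \<one>\<^bsub>UP\<^esub>"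
    unfolding cls_one
    by (subst cls_eq_iff) (auto simp: product_ring_simps cring.cring_simprules[OF cring] intro: U_mono[OF J_in_U])
qed

text \<open>By \<open>UP_carrierE\<close> the homomorphism \<open>cls\<close> maps the full product
  onto the ultraproduct, so the laws of commutative rings are inherited from the product.\<close>

lemma cring_UP: "cring UP"
proof -
  interpret P: cring "product_ring J Bs" by (rule cring_product_ring)
  have "cls ` carrier (product_ring J Bs) = carrier UP"
    using UP_carrierE cls_closed product_ring_evI by blast
  moreover have "cls \<zero>\<^bsub>product_ring J Bs\<^esub> = \<zero>\<^bsub>UP\<^esub>"
    unfolding cls_zero
    by (subst cls_eq_iff) (auto simp: product_ring_simps cring.cring_simprules[OF cring] intro: U_mono[OF J_in_U])
  ultimately have "ring UP"
    using P.ring_hom_imp_img_ring[OF cls_hom] by simp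
  then show ?thesis
  proof (rule cring.intro)
    interpret ring UP by fact
    show "comm_monoid UP"
    proof (rule monoid.monoid_comm_monoidI[OF monoid_axioms])
      fix p q assume "p \<in> carrier UP" "q \<in> carrier UP"
      then show "p \<otimes>\<^bsub>UP\<^esub> q = q \<otimes>\<^bsub>UP\<^esub> p"
        by (elim UP_carrierE) (metis P.m_comm ring_hom_mult[OF cls_hom])
    qed
  qed
qed

end

section \<open>Homomorphisms from finitely presented rings to an ultraproduct\<close>

context cring_ultraproduct
begin

lemma UP_ring: "ring UP"
  by (rule cring.axioms(1)[OF cring_UP])

text \<open>The ring laws hold in every factor where \<open>c j\<close> is a homomorphism, and these
  factors form a member of \<open>U\<close>. This direction holds for every ring \<open>Q\<close>;
  the converse rests on finite presentation.\<close>

lemma Hom_UP_of_family: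
  assumes "ring Q" and c: "{j \<in> J. c j \<in> Hom Q (Bs j)} \<in> U"
  shows "(\<lambda>q\<in>carrier Q. cls (\<lambda>j. c j q)) \<in> Hom Q UP"
proof -
  interpret Q: ring Q by fact
  let ?S = "{j \<in> J. c j \<in> Hom Q (Bs j)}"
  have c_in: "c j \<in> ring_hom Q (Bs j)" if "j \<in> ?S" for j
    using that by (simp add: Hom_def)
  have ev: "{j \<in> J. c j q \<in> carrier (Bs j)} \<in> U" if "q \<in> carrier Q" for q
    by (rule U_mono[OF c]) (use ring_hom_closed[OF c_in that] in auto)
  have cong: "cls g = cls h"
    if "{j \<in> J. g j \<in> carrier (Bs j)} \<in> U" "\<And>j. j \<in> ?S \<Longrightarrow> g j = h j" for g h
    using that by (subst cls_eq_iff) (auto intro: U_mono[OF c])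
  have "(\<lambda>q\<in>carrier Q. cls (\<lambda>j. c j q)) \<in> ring_hom Q UP"
  proof (rule ring_hom_memI)
    fix x y assume xy: "x \<in> carrier Q" "y \<in> carrier Q"
    then show "(\<lambda>q\<in>carrier Q. cls (\<lambda>j. c j q)) x \<in> carrier UP"
      by (simp add: cls_closed ev)
    have "cls (\<lambda>j. c j (x \<otimes>\<^bsub>Q\<^esub> y)) = cls (\<lambda>j. c j x \<otimes>\<^bsub>Bs j\<^esub> c j y)"
      using xy by (intro cong ev ring_hom_mult[OF c_in]) auto
    then show "(\<lambda>q\<in>carrier Q. cls (\<lambda>j. c j q)) (x \<otimes>\<^bsub>Q\<^esub> y) =
        (\<lambda>q\<in>carrier Q. cls (\<lambda>j. c j q)) x \<otimes>\<^bsub>UP\<^esub> (\<lambda>q\<in>carrier Q. cls (\<lambda>j. c j q)) y"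
      using xy by (simp add: cls_mult ev)
    have "cls (\<lambda>j. c j (x \<oplus>\<^bsub>Q\<^esub> y)) = cls (\<lambda>j. c j x \<oplus>\<^bsub>Bs j\<^esub> c j y)"
      using xy by (intro cong ev ring_hom_add[OF c_in]) auto
    then show "(\<lambda>q\<in>carrier Q. cls (\<lambda>j. c j q)) (x \<oplus>\<^bsub>Q\<^esub> y) =
        (\<lambda>q\<in>carrier Q. cls (\<lambda>j. c j q)) x \<oplus>\<^bsub>UP\<^esub> (\<lambda>q\<in>carrier Q. cls (\<lambda>j. c j q)) y"
      using xy by (simp add: cls_add ev)
  next
    have "cls (\<lambda>j. c j \<one>\<^bsub>Q\<^esub>) = cls (\<lambda>j. \<one>\<^bsub>Bs j\<^esub>)"
      by (intro cong ev ring_hom_one[OF c_in]) auto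
    then show "(\<lambda>q\<in>carrier Q. cls (\<lambda>j. c j q)) \<one>\<^bsub>Q\<^esub> = \<one>\<^bsub>UP\<^esub>"
      by (simp add: cls_one)
  qed
  then show ?thesis
    by (simp add: Hom_def)
qed

text \<open>Only finitely many relations have to hold in a factor for a lift to factor through \<open>Q\<close>.\<close>

lemma Hom_UP_lift:
  assumes Q: "Q \<in> fp_rings" and h: "h \<in> Hom Q UP"
  obtains c where "{j \<in> J. c j \<in> Hom Q (Bs j)} \<in> U"
    "\<And>q. q \<in> carrier Q \<Longrightarrow> h q = cls (\<lambda>j. c j q)"
proof -
  obtain n F where F: "finite F" "F \<subseteq> carrier (zpoly_ring n)" and Q_eq: "Q = quot_ring n F"
    using Q by (auto simp: fp_rings_iff)
  let ?\<pi> = "quot_proj n F" and ?Z = "carrier (zpoly_ring n)"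
  note \<pi> = quot_proj_hom[OF F(2), folded Q_eq]
  have h': "h \<in> ring_hom Q UP" using h by (simp add: Hom_def)
  have h\<pi>: "h \<circ> ?\<pi> \<in> ring_hom (zpoly_ring n) UP"
    by (rule ring_hom_trans[OF \<pi> h'])
  have "\<exists>g. g \<in> carrier (product_ring J Bs) \<and> h (?\<pi> (zvar i)) = cls g" if "i < n" for i
    using ring_hom_closed[OF h\<pi>, of "zvar i"] that by (auto elim: UP_carrierE)
  then obtain g where g: "\<And>i. i < n \<Longrightarrow> g i \<in> carrier (product_ring J Bs)"
    "\<And>i. i < n \<Longrightarrow> h (?\<pi> (zvar i)) = cls (g i)"
    by metis
  \<comment> \<open>Since the polynomial ring is free, chosen families for the images of the
    variables extend to a homomorphism into the full product. It lifts \<open>h\<close> but may fail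
    to kill the relations in some factors.\<close>
  obtain \<phi> where \<phi>: "\<phi> \<in> ring_hom (zpoly_ring n) (product_ring J Bs)"
    and \<phi>_var: "\<And>i. i < n \<Longrightarrow> \<phi> (zvar i) = g i"
    using zpoly_ring_hom_exists[OF cring_product_ring, of n g] g(1) by blast
  have h_\<phi>: "h (?\<pi> p) = cls (\<phi> p)" if p: "p \<in> ?Z" for p
  proof -
    have "(h \<circ> ?\<pi>) p = (cls \<circ> \<phi>) p"
      using UP_ring h\<pi> ring_hom_trans[OF \<phi> cls_hom] _ p
      by (rule zpoly_ring_hom_eqI) (simp add: g \<phi>_var)
    then show ?thesis by simp
  qed
  have \<phi>_carrier: "\<phi> p j \<in> carrier (Bs j)" if "p \<in> ?Z" "j \<in> J" for p j
    using ring_hom_closed[OF \<phi> that(1)] that(2) by (auto simp: carrier_product_ring)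
  have \<phi>_hom: "(\<lambda>p. \<phi> p j) \<in> ring_hom (zpoly_ring n) (Bs j)" if j: "j \<in> J" for j
    using j ring_hom_mult[OF \<phi>] ring_hom_add[OF \<phi>] ring_hom_one[OF \<phi>]
    by (intro ring_hom_memI) (auto simp: \<phi>_carrier product_ring_simps)
  let ?S = "{j \<in> J. \<forall>p\<in>F. j \<in> {j \<in> J. \<phi> p j = \<zero>\<^bsub>Bs j\<^esub>}}"
  have "?S \<in> U"
  proof (rule U_INT[OF F(1)])
    fix p assume p: "p \<in> F"
    then have pZ: "p \<in> ?Z" using F(2) by blast
    have "h (?\<pi> p) = \<zero>\<^bsub>UP\<^esub>"
      using quot_proj_eq_zero[OF F(2) p] ring_hom_zero[OF h' _ UP_ring]
        cring.axioms(1)[OF cring_quot_ring[OF F(2)]] by (simp add: Q_eq)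
    then have "cls (\<phi> p) = cls (\<lambda>j. \<zero>\<^bsub>Bs j\<^esub>)"
      using h_\<phi>[OF pZ] cls_zero by simp
    then show "{j \<in> J. \<phi> p j = \<zero>\<^bsub>Bs j\<^esub>} \<in> U"
      using cls_eq_iff[of "\<phi> p"] product_ring_evI[OF ring_hom_closed[OF \<phi> pZ]] by simp
  qed
  have c_ex: "\<exists>c. c \<in> Hom Q (Bs j) \<and> (\<forall>p\<in>?Z. c (?\<pi> p) = \<phi> p j)" if j: "j \<in> ?S" for j
  proof -
    have jJ: "j \<in> J" and F0: "\<And>p. p \<in> F \<Longrightarrow> \<phi> p j = \<zero>\<^bsub>Bs j\<^esub>" using j by auto
    show ?thesis
      using quot_ring_lift[OF F(2) cring.axioms(1)[OF cring[OF jJ]] \<phi>_hom[OF jJ] F0]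
      unfolding Q_eq by metis
  qed
  define c where "c j = (SOME c. c \<in> Hom Q (Bs j) \<and> (\<forall>p\<in>?Z. c (?\<pi> p) = \<phi> p j))" for j
  have c: "c j \<in> Hom Q (Bs j)" "\<And>p. p \<in> ?Z \<Longrightarrow> c j (?\<pi> p) = \<phi> p j" if "j \<in> ?S" for j
    using someI_ex[OF c_ex[OF that]] unfolding c_def by blast+
  show thesis
  proof (rule that)
    show "{j \<in> J. c j \<in> Hom Q (Bs j)} \<in> U"
      by (rule U_mono[OF \<open>?S \<in> U\<close>]) (use c(1) in auto)
    fix q assume "q \<in> carrier Q"
    then obtain p where p: "p \<in> ?Z" "q = ?\<pi> p"
      by (auto simp: Q_eq carrier_quot_ring)
    have "{j \<in> J. \<phi> p j = c j q} \<in> U"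
      by (rule U_mono[OF \<open>?S \<in> U\<close>]) (use c(2) p in auto)
    then have "cls (\<phi> p) = cls (\<lambda>j. c j q)"
      using cls_eq_iff[OF product_ring_evI[OF ring_hom_closed[OF \<phi> p(1)]]] by blast
    then show "h q = cls (\<lambda>j. c j q)"
      using h_\<phi> p by simp
  qed
qed

text \<open>Equality of classes gives one member of \<open>U\<close> for each element
  \<open>p\<close>. Only the finitely many generators of \<open>P\<close> matter, so a single member
  of \<open>U\<close> works for all of them, and there the two homomorphisms coincide.\<close>

lemma family_eventually_eqI:
  assumes P: "P \<in> fp_rings"
    and c: "{j \<in> J. c j \<in> Hom P (Bs j)} \<in> U" and d: "{j \<in> J. d j \<in> Hom P (Bs j)} \<in> U"
    and eq: "\<And>p. p \<in> carrier P \<Longrightarrow> cls (\<lambda>j. c j p) = cls (\<lambda>j. d j p)"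
  shows "{j \<in> J. c j = d j} \<in> U"
proof -
  obtain n F where F: "finite F" "F \<subseteq> carrier (zpoly_ring n)" and P_eq: "P = quot_ring n F"
    using P by (auto simp: fp_rings_iff)
  let ?gen = "\<lambda>i. quot_proj n F (zvar i)"
  let ?S = "{j \<in> J. \<forall>i\<in>{..<n}. j \<in> {j \<in> J. c j (?gen i) = d j (?gen i)}}"
  have "?S \<in> U"
  proof (rule U_INT)
    fix i assume "i \<in> {..<n}"
    then have gen: "?gen i \<in> carrier P"
      by (simp add: P_eq carrier_quot_ring)
    have "{j \<in> J. c j (?gen i) \<in> carrier (Bs j)} \<in> U"
      by (rule U_mono[OF c]) (use ring_hom_closed gen in \<open>auto simp: Hom_def\<close>)
    then show "{j \<in> J. c j (?gen i) = d j (?gen i)} \<in> U"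
      using eq[OF gen] by (simp add: cls_eq_iff)
  qed simp
  then have "?S \<inter> ({j \<in> J. c j \<in> Hom P (Bs j)} \<inter> {j \<in> J. d j \<in> Hom P (Bs j)}) \<in> U"
    by (intro U_Int c d)
  then show ?thesis
  proof (rule U_mono)
    show "?S \<inter> ({j \<in> J. c j \<in> Hom P (Bs j)} \<inter> {j \<in> J. d j \<in> Hom P (Bs j)}) \<subseteq> {j \<in> J. c j = d j}"
      using Hom_quot_ring_eqI[OF F(2) cring.axioms(1)[OF cring]] by (auto simp: P_eq)
  qed auto
qed

end

section \<open>The homomorphism defined by eventually commuting cocones\<close>

text \<open>\<open>quot_ring 1 {}\<close> is the polynomial ring in one variable, which represents
  the underlying set functor: over a commutative ring \<open>R\<close>, the chosen map is the unique
  homomorphism that sends the variable to \<open>r\<close>.\<close>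

definition point :: "('r, 's) ring_scheme \<Rightarrow> 'r \<Rightarrow> zpoly set \<Rightarrow> 'r"
  where "point R r = (SOME e. e \<in> Hom (quot_ring 1 {}) R \<and> e (quot_proj 1 {} (zvar 0)) = r)"

text \<open>Evaluation of polynomials; it is applied with one variable to obtain points and with two
  to put a pair of elements into one object.\<close>

lemma quot_ring_free_Hom_exists:
  assumes R: "cring R" and \<phi>: "\<And>i. i < n \<Longrightarrow> \<phi> i \<in> carrier R"
  shows "\<exists>e. e \<in> Hom (quot_ring n {}) R \<and> (\<forall>i<n. e (quot_proj n {} (zvar i)) = \<phi> i)"
proof -
  obtain h where h: "h \<in> ring_hom (zpoly_ring n) R" "\<And>i. i < n \<Longrightarrow> h (zvar i) = \<phi> i"
    using zpoly_ring_hom_exists[OF R, of n \<phi>] \<phi> by blast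
  obtain e where "e \<in> Hom (quot_ring n {}) R"
    "\<And>p. p \<in> carrier (zpoly_ring n) \<Longrightarrow> e (quot_proj n {} p) = h p"
    using quot_ring_lift[OF _ cring.axioms(1)[OF R] h(1), of "{}"] by auto
  then show ?thesis
    using h(2) by auto
qed

lemma free_quot_ring_in_fp_rings: "quot_ring n {} \<in> fp_rings"
  unfolding fp_rings_iff by blast

lemma point:
  assumes "cring R" "r \<in> carrier R"
  shows "point R r \<in> Hom (quot_ring 1 {}) R" "point R r (quot_proj 1 {} (zvar 0)) = r"
proof -
  have "\<exists>e. e \<in> Hom (quot_ring 1 {}) R \<and> e (quot_proj 1 {} (zvar 0)) = r"
    using quot_ring_free_Hom_exists[OF assms(1), of 1 "\<lambda>_. r"] assms(2) by auto
  from someI_ex[OF this] show "point R r \<in> Hom (quot_ring 1 {}) R" "point R r (quot_proj 1 {} (zvar 0)) = r"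
    unfolding point_def by blast+
qed

text \<open>Both composites send the variable to \<open>a p\<close>. The arrow links the object
  given by an element of \<open>A\<close> to every finitely presented ring through which this
  element is reached.\<close>

lemma point_arrow:
  assumes A: "cring A" and x: "(P, a) \<in> elements A" and p: "p \<in> carrier P"
  shows "((quot_ring 1 {}, point A (a p)), point P p, (P, a)) \<in> element_arrows A"
proof -
  have P: "P \<in> fp_rings" and a: "a \<in> Hom P A" using x by (auto simp: elements_def)
  note P' = cring_fp_ring[OF P]
  note pt = point[OF P' p]
  have ap: "a p \<in> carrier A"
    using a p by (auto simp: Hom_def ring_hom_closed)
  have gen: "quot_proj 1 {} (zvar 0) \<in> carrier (quot_ring 1 {})"
    by (simp add: carrier_quot_ring)
  have "compose (carrier (quot_ring 1 {})) a (point P p) = point A (a p)"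
  proof (rule Hom_quot_ring_eqI[OF _ cring.axioms(1)[OF A]])
    show "compose (carrier (quot_ring 1 {})) a (point P p) \<in> Hom (quot_ring 1 {}) A"
      using cring.axioms(1)[OF cring_quot_ring] pt(1) a by (intro Hom_compose) auto
    show "point A (a p) \<in> Hom (quot_ring 1 {}) A"
      by (rule point(1)[OF A ap])
  qed (use pt(2) point(2)[OF A ap] gen in \<open>simp_all add: compose_def\<close>)
  then show ?thesis
    using x pt(1) point(1)[OF A ap] free_quot_ring_in_fp_rings
    unfolding element_arrows_def by (auto simp: elements_def)
qed

text \<open>No single \<open>fs j\<close> has to be a cocone on the whole category of elements. Each
  object and each arrow has its own member of \<open>U\<close>, and the ultraproduct assembles these
  conditions into a genuine cocone.\<close>

locale eventual_cocone = cring_ultraproduct J U Bs + A: cring A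
  for J :: "'j set" and U and Bs :: "'j \<Rightarrow> 'b ring" and A :: "'a ring" +
  fixes fs :: "'j \<Rightarrow> 'a el \<Rightarrow> zpoly set \<Rightarrow> 'b"
  assumes fs_Hom: "x \<in> elements A \<Longrightarrow> {j \<in> J. fs j x \<in> Hom (fst x) (Bs j)} \<in> U"
    and fs_compose: "(x, u, y) \<in> element_arrows A \<Longrightarrow>
      {j \<in> J. compose (carrier (fst x)) (fs j y) u = fs j x} \<in> U"
begin

definition lim_map :: "'a \<Rightarrow> ('j set \<times> ('j \<Rightarrow> 'b)) set"
  where "lim_map = (\<lambda>a\<in>carrier A.
    cls (\<lambda>j. fs j (quot_ring 1 {}, point A a) (quot_proj 1 {} (zvar 0))))"

lemma fs_carrier:
  assumes x: "x \<in> elements A" and p: "p \<in> carrier (fst x)"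
  shows "{j \<in> J. fs j x p \<in> carrier (Bs j)} \<in> U"
  by (rule U_mono[OF fs_Hom[OF x]]) (use p in \<open>auto simp: Hom_def ring_hom_closed\<close>)

text \<open>Along the arrow \<open>point P p\<close>, the components at the point \<open>a p\<close>
  and at \<open>(P, a)\<close> agree for almost all \<open>j\<close>. So the value of
  \<open>lim_map\<close> can be computed from any object that reaches the element.\<close>

lemma lim_map_eq:
  assumes x: "(P, a) \<in> elements A" and p: "p \<in> carrier P"
  shows "lim_map (a p) = cls (\<lambda>j. fs j (P, a) p)"
proof -
  let ?z = "(quot_ring 1 {}, point A (a p))" and ?X = "quot_proj 1 {} (zvar 0)"
  have P: "P \<in> fp_rings" and a: "a p \<in> carrier A"
    using x p by (auto simp: elements_def Hom_def ring_hom_closed)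
  have gen: "?X \<in> carrier (quot_ring 1 {})"
    by (simp add: carrier_quot_ring)
  have z: "?z \<in> elements A"
    using point(1)[OF A.is_cring a] free_quot_ring_in_fp_rings by (simp add: elements_def)
  have "{j \<in> J. fs j ?z ?X = fs j (P, a) p} \<in> U"
  proof (rule U_mono[OF fs_compose[OF point_arrow[OF A.is_cring x p]]])
    show "{j \<in> J. compose (carrier (fst ?z)) (fs j (P, a)) (point P p) = fs j ?z}
        \<subseteq> {j \<in> J. fs j ?z ?X = fs j (P, a) p}"
    proof safe
      fix j assume "compose (carrier (fst ?z)) (fs j (P, a)) (point P p) = fs j ?z"
      then have "fs j ?z ?X = compose (carrier (fst ?z)) (fs j (P, a)) (point P p) ?X" by simp
      then show "fs j ?z ?X = fs j (P, a) p"
        using gen point(2)[OF cring_fp_ring[OF P] p] by (simp add: compose_eq)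
    qed
  qed auto
  then have "cls (\<lambda>j. fs j ?z ?X) = cls (\<lambda>j. fs j (P, a) p)"
    using cls_eq_iff[OF fs_carrier[OF z, of ?X]] gen by simp
  then show ?thesis
    using a by (simp add: lim_map_def)
qed

lemma hom_cocone_lim_map:
  assumes "(P, a) \<in> elements A"
  shows "hom_cocone lim_map (P, a) = (\<lambda>p\<in>carrier P. cls (\<lambda>j. fs j (P, a) p))"
  using lim_map_eq[OF assms] by (simp add: hom_cocone_def compose_def cong: restrict_cong)

text \<open>Two elements of \<open>A\<close> are values of one homomorphism \<open>e\<close> from
  the polynomial ring in two variables. On that object \<open>lim_map\<close> after \<open>e\<close>
  is the class of a family of homomorphisms, so sums and products are preserved.\<close>

lemma lim_map_Hom: "lim_map \<in> Hom A UP"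
proof -
  have pair: "\<exists>P e p q. (P, e) \<in> elements A \<and> p \<in> carrier P \<and> q \<in> carrier P \<and> e p = a \<and> e q = b"
    if ab: "a \<in> carrier A" "b \<in> carrier A" for a b
  proof -
    have "\<exists>e. e \<in> Hom (quot_ring 2 {}) A
        \<and> (\<forall>i<2. e (quot_proj 2 {} (zvar i)) = (if i = 0 then a else b))"
      by (rule quot_ring_free_Hom_exists[OF A.is_cring]) (use ab in auto)
    then obtain e where "e \<in> Hom (quot_ring 2 {}) A"
      "\<forall>i<2. e (quot_proj 2 {} (zvar i)) = (if i = 0 then a else b)"
      by blast
    then show ?thesis
      using free_quot_ring_in_fp_rings[of 2]
      by (intro exI[of _ "quot_ring 2 {}"] exI[of _ e] exI[of _ "quot_proj 2 {} (zvar 0)"]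
          exI[of _ "quot_proj 2 {} (zvar 1)"])
        (auto simp: elements_def carrier_quot_ring)
  qed
  have hom: "hom_cocone lim_map (P, e) \<in> Hom P UP" if "(P, e) \<in> elements A" for P e
    using Hom_UP_of_family[OF _ fs_Hom[OF that]] that cring.axioms(1)[OF cring_fp_ring]
    by (simp add: hom_cocone_lim_map elements_def)
  have "lim_map \<in> ring_hom A UP"
  proof (rule ring_hom_memI)
    fix a b assume "a \<in> carrier A" "b \<in> carrier A"
    then obtain P e p q where x: "(P, e) \<in> elements A" and pq: "p \<in> carrier P" "q \<in> carrier P"
      and ab: "a = e p" "b = e q" using pair by metis
    interpret P: cring P
      using x cring_fp_ring by (simp add: elements_def)
    have e: "e \<in> ring_hom P A" using x by (simp add: elements_def Hom_def)
    have L: "hom_cocone lim_map (P, e) \<in> ring_hom P UP"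
      using hom[OF x] by (simp add: Hom_def)
    have L_eq: "hom_cocone lim_map (P, e) r = lim_map (e r)" if "r \<in> carrier P" for r
      using that by (simp add: hom_cocone_def compose_eq)
    show "lim_map a \<in> carrier UP"
      using ring_hom_closed[OF L pq(1)] by (simp add: L_eq pq ab)
    show "lim_map (a \<otimes>\<^bsub>A\<^esub> b) = lim_map a \<otimes>\<^bsub>UP\<^esub> lim_map b"
      using ring_hom_mult[OF L pq] ring_hom_mult[OF e pq] by (simp add: L_eq pq ab)
    show "lim_map (a \<oplus>\<^bsub>A\<^esub> b) = lim_map a \<oplus>\<^bsub>UP\<^esub> lim_map b"
      using ring_hom_add[OF L pq] ring_hom_add[OF e pq] by (simp add: L_eq pq ab)
  next
    obtain P e where x: "(P, e) \<in> elements A"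
      using pair[of "\<one>\<^bsub>A\<^esub>" "\<one>\<^bsub>A\<^esub>"] by auto
    interpret P: cring P
      using x cring_fp_ring by (simp add: elements_def)
    have e: "e \<one>\<^bsub>P\<^esub> = \<one>\<^bsub>A\<^esub>" using x ring_hom_one by (auto simp: elements_def Hom_def)
    have "hom_cocone lim_map (P, e) \<one>\<^bsub>P\<^esub> = \<one>\<^bsub>UP\<^esub>"
      using hom[OF x] ring_hom_one by (auto simp: Hom_def)
    then show "lim_map \<one>\<^bsub>A\<^esub> = \<one>\<^bsub>UP\<^esub>"
      using e by (simp add: hom_cocone_def compose_eq)
  qed
  then show ?thesis
    by (simp add: Hom_def lim_map_def)
qed

text \<open>This is the theorem of Los for primitive formulas. A witness in the ultraproduct lifts
  to almost all factors because \<open>Q\<close> is finitely presented, and the lifted witnesses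
  match the parameter almost everywhere because \<open>P\<close> is finitely generated. Conversely,
  chosen witnesses in the factors define one in the ultraproduct. Realising uses the second
  implication, avoiding the first.\<close>

lemma hom_cocone_lim_map_in_ex_image_iff:
  assumes m: "(P, Q, m) \<in> prims" and a: "a \<in> Hom P A"
  shows "hom_cocone lim_map (P, a) \<in> ex_image UP (P, Q, m) \<longleftrightarrow>
    {j \<in> J. fs j (P, a) \<in> ex_image (Bs j) (P, Q, m)} \<in> U" (is "_ \<longleftrightarrow> ?S \<in> U")
proof
  have P: "P \<in> fp_rings" and Q: "Q \<in> fp_rings" and m_Hom: "m \<in> Hom P Q"
    using m by (auto simp: prims_def)
  note P_ring = cring.axioms(1)[OF cring_fp_ring[OF P]]
  note Q_ring = cring.axioms(1)[OF cring_fp_ring[OF Q]]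
  have x: "(P, a) \<in> elements A" using P a by (simp add: elements_def)
  have m_closed: "m p \<in> carrier Q" if "p \<in> carrier P" for p
    using m_Hom that by (auto simp: Hom_def ring_hom_closed)
  show "?S \<in> U" if "hom_cocone lim_map (P, a) \<in> ex_image UP (P, Q, m)"
  proof -
    obtain h where h: "h \<in> Hom Q UP" and h_eq: "hom_cocone lim_map (P, a) = compose (carrier P) h m"
      using \<open>hom_cocone lim_map (P, a) \<in> _\<close> by (auto simp: ex_image_def)
    obtain c where c: "{j \<in> J. c j \<in> Hom Q (Bs j)} \<in> U"
      and h_c: "\<And>q. q \<in> carrier Q \<Longrightarrow> h q = cls (\<lambda>j. c j q)"
      using Hom_UP_lift[OF Q h] by blast
    have "{j \<in> J. compose (carrier P) (c j) m = fs j (P, a)} \<in> U"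
    proof (rule family_eventually_eqI[OF P])
      show "{j \<in> J. compose (carrier P) (c j) m \<in> Hom P (Bs j)} \<in> U"
        by (rule U_mono[OF c]) (use Hom_compose[OF P_ring m_Hom] in auto)
      show "{j \<in> J. fs j (P, a) \<in> Hom P (Bs j)} \<in> U"
        using fs_Hom[OF x] by simp
      fix p assume p: "p \<in> carrier P"
      have "cls (\<lambda>j. compose (carrier P) (c j) m p) = h (m p)"
        using h_c[OF m_closed[OF p]] p by (simp add: compose_eq)
      also have "\<dots> = hom_cocone lim_map (P, a) p"
        unfolding h_eq using p by (simp add: compose_eq)
      also have "\<dots> = cls (\<lambda>j. fs j (P, a) p)"
        using p by (simp add: hom_cocone_lim_map[OF x])
      finally show "cls (\<lambda>j. compose (carrier P) (c j) m p) = cls (\<lambda>j. fs j (P, a) p)" .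
    qed
    from U_Int[OF this c] show ?thesis
      by (rule U_mono) (auto simp: ex_image_def image_iff intro: sym)
  qed
  show "hom_cocone lim_map (P, a) \<in> ex_image UP (P, Q, m)" if S: "?S \<in> U"
  proof -
    define c where "c j = (SOME c. c \<in> Hom Q (Bs j) \<and> fs j (P, a) = compose (carrier P) c m)" for j
    have c: "c j \<in> Hom Q (Bs j) \<and> fs j (P, a) = compose (carrier P) (c j) m" if "j \<in> ?S" for j
    proof -
      have "\<exists>c. c \<in> Hom Q (Bs j) \<and> fs j (P, a) = compose (carrier P) c m"
        using that by (auto simp: ex_image_def)
      from someI_ex[OF this] show ?thesis
        unfolding c_def .
    qed
    have c_Hom: "{j \<in> J. c j \<in> Hom Q (Bs j)} \<in> U"
      by (rule U_mono[OF S]) (use c in auto)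
    define h where "h = (\<lambda>q\<in>carrier Q. cls (\<lambda>j. c j q))"
    have h: "h \<in> Hom Q UP"
      unfolding h_def by (rule Hom_UP_of_family[OF Q_ring c_Hom])
    have "hom_cocone lim_map (P, a) p = compose (carrier P) h m p" if p: "p \<in> carrier P" for p
    proof -
      have "fs j (P, a) p = c j (m p)" if "j \<in> ?S" for j
        using conjunct2[OF c[OF that]] p by (simp add: compose_eq)
      then have "{j \<in> J. fs j (P, a) p = c j (m p)} \<in> U"
        by (intro U_mono[OF S]) auto
      then have "cls (\<lambda>j. fs j (P, a) p) = cls (\<lambda>j. c j (m p))"
        using cls_eq_iff[OF fs_carrier[OF x, of p]] p by simp
      then show ?thesis
        using p m_closed[OF p] by (simp add: hom_cocone_lim_map[OF x] compose_eq h_def)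
    qed
    then have "hom_cocone lim_map (P, a) = compose (carrier P) h m"
      by (intro extensionalityI[of _ "carrier P"]) (auto simp: hom_cocone_def)
    then show ?thesis
      using h by (auto simp: ex_image_def)
  qed
qed

end

section \<open>The ultrafilter of finite tests and the resulting homomorphism\<close>

theorem theorem2p3:
  fixes A :: "'a ring" and C :: "'b ring set" and X Y :: "'a param_prim set"
  assumes "cring A"
    and "\<And>B. B \<in> C \<Longrightarrow> cring B"
    and "X \<subseteq> param_prims A" and "Y \<subseteq> param_prims A"
    and "\<And>X0 Y0 I0 I1.
      \<lbrakk> finite X0; X0 \<subseteq> X; finite Y0; Y0 \<subseteq> Y;
        finite_subcategory A I0 I1; parameter ` (X0 \<union> Y0) \<subseteq> I0 \<rbrakk>
      \<Longrightarrow> \<exists>B\<in>C. \<exists>f. cocone I0 I1 B f \<and> realises B f X0 \<and> avoids B f Y0"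
  shows "\<exists>(J :: 'a ultra_index set) U Bs f.
    ultrafilter_on J U \<and> (\<forall>j\<in>J. Bs j \<in> C) \<and>
    f \<in> Hom A (ultraproduct U Bs) \<and>
    realises (ultraproduct U Bs) (hom_cocone f) X \<and>
    avoids (ultraproduct U Bs) (hom_cocone f) Y"
proof -
  interpret A: cring A by fact
  define J :: "'a ultra_index set" where "J = {(X0, Y0, I0, I1).
    finite X0 \<and> X0 \<subseteq> X \<and> finite Y0 \<and> Y0 \<subseteq> Y \<and> finite_subcategory A I0 I1 \<and>
    parameter ` (X0 \<union> Y0) \<subseteq> I0}"
  define good :: "'a ultra_index \<Rightarrow> 'b ring \<times> ('a el \<Rightarrow> zpoly set \<Rightarrow> 'b) \<Rightarrow> bool" where "good = (\<lambda>(X0, Y0, I0, I1) (B, f).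
    B \<in> C \<and> cocone I0 I1 B f \<and> realises B f X0 \<and> avoids B f Y0)"
  have "\<exists>Bf. good j Bf" if j: "j \<in> J" for j
  proof -
    obtain X0 Y0 I0 I1 where j_eq: "j = (X0, Y0, I0, I1)" by (cases j)
    have "\<exists>B\<in>C. \<exists>f. cocone I0 I1 B f \<and> realises B f X0 \<and> avoids B f Y0"
      using j by (intro assms(5)) (auto simp: J_def j_eq)
    then show ?thesis
      by (auto simp: good_def j_eq)
  qed
  then have "\<forall>j\<in>J. \<exists>Bf. good j Bf" ..
  from bchoice[OF this] obtain Bf where Bf: "\<And>j. j \<in> J \<Longrightarrow> good j (Bf j)"
    by blast
  define Bs where "Bs j = fst (Bf j)" for j
  define fs where "fs j = snd (Bf j)" for j
  have fs: "Bs (X0, Y0, I0, I1) \<in> C" "cocone I0 I1 (Bs (X0, Y0, I0, I1)) (fs (X0, Y0, I0, I1))"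
    "realises (Bs (X0, Y0, I0, I1)) (fs (X0, Y0, I0, I1)) X0"
    "avoids (Bs (X0, Y0, I0, I1)) (fs (X0, Y0, I0, I1)) Y0"
    if "(X0, Y0, I0, I1) \<in> J" for X0 Y0 I0 I1
    using Bf[OF that] by (auto simp: good_def Bs_def fs_def split: prod.splits)
  have Bs_C: "Bs j \<in> C" if "j \<in> J" for j
    using fs(1) that by (cases j) auto

  \<comment> \<open>A subcategory indexed by \<open>j\<close> need not contain the arrows in \<open>Ar\<close>; only the commutation of
    the chosen cocone with them is required. Hence these sets are closed under intersection
    although finite subcategories are not directed.\<close>
  define K where "K = (\<lambda>(X0, Y0, Ob, Ar). {j \<in> J. X0 \<subseteq> fst j \<and> Y0 \<subseteq> fst (snd j)
    \<and> Ob \<subseteq> fst (snd (snd j)) \<and>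
    (\<forall>(x, v, y)\<in>Ar. compose (carrier (fst x)) (fs j y) v = fs j x)})"
  define T where "T = {(X0, Y0, Ob, Ar). finite X0 \<and> X0 \<subseteq> X \<and> finite Y0 \<and> Y0 \<subseteq> Y \<and>
    finite Ob \<and> Ob \<subseteq> elements A \<and> finite Ar \<and> Ar \<subseteq> element_arrows A}"
  have param_elements: "parameter q \<in> elements A" if "q \<in> X \<union> Y" for q
    using that assms(3,4)
    by (auto simp: param_prims_def prims_def parameter_def prim_dom_def elements_def)
  have K_nonempty: "K t \<noteq> {}" if "t \<in> T" for t
  proof -
    obtain X0 Y0 Ob Ar where t: "t = (X0, Y0, Ob, Ar)" by (cases t)
    have X0: "finite X0" "X0 \<subseteq> X" and Y0: "finite Y0" "Y0 \<subseteq> Y"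
      and Ob: "finite Ob" "Ob \<subseteq> elements A" and Ar: "finite Ar" "Ar \<subseteq> element_arrows A"
      using \<open>t \<in> T\<close> by (auto simp: T_def t)
    \<comment> \<open>The parameters must be objects for the star to be an admissible test, and the
      end points of the arrows must be objects for the legs to be defined there.\<close>
    define Ob' where "Ob' = Ob \<union> parameter ` (X0 \<union> Y0) \<union> fst ` Ar \<union> (\<lambda>e. snd (snd e)) ` Ar"
    have Ob': "finite Ob'" "Ob' \<subseteq> elements A"
    proof -
      show "finite Ob'" using Ob X0 Y0 Ar by (simp add: Ob'_def)
      have "fst e \<in> elements A \<and> snd (snd e) \<in> elements A" if "e \<in> Ar" for e
        using Ar(2) that by (auto simp: element_arrows_def)
      then show "Ob' \<subseteq> elements A"
        using Ob(2) param_elements X0(2) Y0(2) by (auto simp: Ob'_def)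
    qed
    have Ar_Ob': "x \<in> Ob' \<and> y \<in> Ob'" if "(x, v, y) \<in> Ar" for x v y
      using that by (force simp: Ob'_def)
    obtain Q b u where z: "(Q, b) \<in> elements A" "(Q, b) \<notin> Ob'"
      and u: "\<And>x. x \<in> Ob' \<Longrightarrow> u x \<in> Hom (fst x) Q"
        "\<And>x. x \<in> Ob' \<Longrightarrow> compose (carrier (fst x)) b (u x) = snd x"
      and u_comm: "\<And>x v y. (x, v, y) \<in> Ar \<Longrightarrow> compose (carrier (fst x)) (u y) v = u x"
      by (rule elements_cocone_exists[OF A.is_cring Ob' Ar Ar_Ob']) blast+
    define I0 where "I0 = insert (Q, b) Ob'"
    define I1 where "I1 = (\<lambda>x. (x, restrict id (carrier (fst x)), x)) ` insert (Q, b) Ob'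
      \<union> (\<lambda>x. (x, u x, (Q, b))) ` Ob'"
    let ?j = "(X0, Y0, I0, I1)"
    have "finite_subcategory A I0 I1"
      unfolding I0_def I1_def by (rule finite_subcategory_star[OF Ob' z u])
    then have j: "?j \<in> J"
      using X0 Y0 by (auto simp: J_def I0_def Ob'_def)
    have star: "compose (carrier (fst x)) (fs ?j (Q, b)) (u x) = fs ?j x" if "x \<in> Ob'" for x
      using fs(2)[OF j] that unfolding cocone_def I1_def by blast
    \<comment> \<open>The arrow \<open>v\<close> need not belong to the star. Commutation follows
      through the apex: the component at \<open>y\<close> is the leg at \<open>y\<close> followed by
      the component at the apex, and the leg at \<open>y\<close> after \<open>v\<close> is the leg
      at \<open>x\<close>.\<close>
    have "compose (carrier (fst x)) (fs ?j y) v = fs ?j x" if e: "(x, v, y) \<in> Ar" for x v y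
    proof -
      have xy: "x \<in> Ob'" "y \<in> Ob'" using Ar_Ob'[OF e] by auto
      have "v \<in> Hom (fst x) (fst y)"
        using Ar(2) e by (auto simp: element_arrows_def)
      then have v: "v p \<in> carrier (fst y)" if "p \<in> carrier (fst x)" for p
        using that by (auto simp: Hom_def ring_hom_closed)
      have "compose (carrier (fst x)) (fs ?j y) v
          = compose (carrier (fst x)) (compose (carrier (fst y)) (fs ?j (Q, b)) (u y)) v"
        by (simp only: star[OF xy(2)])
      also have "\<dots> = compose (carrier (fst x)) (fs ?j (Q, b)) (compose (carrier (fst x)) (u y) v)"
        using v by (auto simp: compose_def restrict_def fun_eq_iff)
      also have "\<dots> = fs ?j x"
        by (simp only: u_comm[OF e] star[OF xy(1)])
      finally show ?thesis .
    qed
    then have "?j \<in> K t"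
      using j by (auto simp: K_def t I0_def Ob'_def)
    then show ?thesis by blast
  qed
  have K_Int: "\<exists>t''\<in>T. K t \<inter> K t' = K t''" if "t \<in> T" "t' \<in> T" for t t'
  proof -
    obtain X0 Y0 Ob Ar X0' Y0' Ob' Ar' where t: "t = (X0, Y0, Ob, Ar)" "t' = (X0', Y0', Ob', Ar')"
      by (cases t, cases t')
    have "K t \<inter> K t' = K (X0 \<union> X0', Y0 \<union> Y0', Ob \<union> Ob', Ar \<union> Ar')"
      unfolding K_def t prod.case ball_Un Un_subset_iff by blast
    moreover have "(X0 \<union> X0', Y0 \<union> Y0', Ob \<union> Ob', Ar \<union> Ar') \<in> T"
      using that by (simp add: T_def t)
    ultimately show ?thesis by blast
  qed
  have "({}, {}, {}, {}) \<in> T" by (simp add: T_def)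
  obtain U where U: "ultrafilter_on J U" and K_U: "K ` T \<subseteq> U"
  proof (rule ultrafilter_on_exists[of "K ` T" J])
    show "K ` T \<subseteq> Pow J" by (auto simp: K_def)
    show "K ` T \<noteq> {}" using \<open>({}, {}, {}, {}) \<in> T\<close> by blast
    show "{} \<notin> K ` T" using K_nonempty by blast
    show "R \<inter> S \<in> K ` T" if "R \<in> K ` T" "S \<in> K ` T" for R S
      using that K_Int by (auto simp: image_iff)
  qed
  interpret cring_ultraproduct J U Bs
    by (intro cring_ultraproduct.intro U assms(2) Bs_C)
  have K_in_U: "K t \<in> U" if "t \<in> T" for t
    using K_U that by blast
  interpret eventual_cocone J U Bs A fs
  proof
    fix x assume x: "x \<in> elements A"
    \<comment> \<open>Requiring \<open>x\<close> to be an object of the test makes the component at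
      \<open>x\<close> a homomorphism; a cocone says nothing about objects outside its index
      category.\<close>
    have "K ({}, {}, {x}, {}) \<in> U"
      using x by (intro K_in_U) (simp add: T_def)
    then show "{j \<in> J. fs j x \<in> Hom (fst x) (Bs j)} \<in> U"
    proof (rule U_mono)
      have "fs j x \<in> Hom (fst x) (Bs j)" if "j \<in> J" "x \<in> fst (snd (snd j))" for j
        using that fs(2) by (cases j) (auto simp: cocone_def)
      then show "K ({}, {}, {x}, {}) \<subseteq> {j \<in> J. fs j x \<in> Hom (fst x) (Bs j)}"
        by (auto simp: K_def)
    qed auto
  next
    fix x u y assume e: "(x, u, y) \<in> element_arrows A"
    have "K ({}, {}, {}, {(x, u, y)}) \<in> U"
      using e by (intro K_in_U) (simp add: T_def)
    then show "{j \<in> J. compose (carrier (fst x)) (fs j y) u = fs j x} \<in> U"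
      by (rule U_mono) (auto simp: K_def)
  qed
  have X_ev: "{j \<in> J. fs j (parameter q) \<in> ex_image (Bs j) (fst q)} \<in> U" if q: "q \<in> X" for q
  proof -
    have "K ({q}, {}, {}, {}) \<in> U"
      using q by (intro K_in_U) (simp add: T_def)
    then show ?thesis
    proof (rule U_mono)
      have "fs j (parameter q) \<in> ex_image (Bs j) (fst q)" if "j \<in> J" "q \<in> fst j" for j
        using that fs(3) by (cases j) (auto simp: realises_def)
      then show "K ({q}, {}, {}, {}) \<subseteq> {j \<in> J. fs j (parameter q) \<in> ex_image (Bs j) (fst q)}"
        by (auto simp: K_def)
    qed auto
  qed
  have Y_ev: "{j \<in> J. fs j (parameter q) \<in> ex_image (Bs j) (fst q)} \<notin> U" if q: "q \<in> Y" for q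
  proof
    assume S: "{j \<in> J. fs j (parameter q) \<in> ex_image (Bs j) (fst q)} \<in> U"
    have "K ({}, {q}, {}, {}) \<in> U"
      using q by (intro K_in_U) (simp add: T_def)
    \<comment> \<open>An index common to both sets would give a cocone that avoids \<open>q\<close>
      and at the same time has its parameter in the image.\<close>
    from U_Int[OF S this] have "{j \<in> J. fs j (parameter q) \<in> ex_image (Bs j) (fst q)} \<inter> K ({}, {q}, {}, {}) \<noteq> {}"
      by (rule contrapos_pn) (simp only: empty_notin_U not_False_eq_True)
    then obtain j where j: "j \<in> J" "q \<in> fst (snd j)" "fs j (parameter q) \<in> ex_image (Bs j) (fst q)"
      by (auto simp: K_def)
    then show False
      using fs(4) by (cases j) (auto simp: avoids_def)
  qed
  have ex_image_iff: "hom_cocone lim_map (parameter q) \<in> ex_image UP (fst q) \<longleftrightarrow>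
    {j \<in> J. fs j (parameter q) \<in> ex_image (Bs j) (fst q)} \<in> U" if "q \<in> X \<union> Y" for q
  proof -
    obtain P Q m a where q: "q = ((P, Q, m), a)" by (metis prod.exhaust)
    have "(P, Q, m) \<in> prims" "a \<in> Hom P A"
      using that assms(3,4) by (auto simp: q param_prims_def prim_dom_def)
    then show ?thesis
      using hom_cocone_lim_map_in_ex_image_iff by (simp add: q parameter_def prim_dom_def)
  qed
  have "realises UP (hom_cocone lim_map) X" "avoids UP (hom_cocone lim_map) Y"
    using ex_image_iff X_ev Y_ev by (simp_all add: realises_def avoids_def)
  then show ?thesis
    using U Bs_C lim_map_Hom by blast
qed

end
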